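(* Let $\lambda\in(0,\tfrac12)$, $\epsilon>0$, $\rho>0$, and let $m,n$ be positive integers with $N=mn$. Let $\hat X_{N,\rho,\epsilon}(\tilde\xi^N)$ be the $\epsilon$-optimal solution set of the inexact compromise decision problem and $X^*_\epsilon$ the $\epsilon$-optimal solution set of the true problem (both defined in the context). Then $$\mathrm{Var}\big[\Delta(\hat X_{N,\rho,\epsilon}(\tilde\xi^N),X^*_\epsilon)\big]\le\frac{64D_X^2M_FN_F}{m\,\epsilon^2n^\lambda}+\Big(\frac{8D_XN_F}{\epsilon n^\lambda}+2\sqrt{\epsilon/\rho}\Big)^2 .$$ Furthermore, let $K$ be a positive constant. If $\rho\ge Kn$, then $$\mathbb E\big[\Delta(\hat X_{N,\rho,\epsilon}(\tilde\xi^N),X^*_\epsilon)\big]=O\Big(\frac1{n^\lambda}\Big),\qquad \mathrm{Var}\big[\Delta(\hat X_{N,\rho,\epsilon}(\tilde\xi^N),X^*_\epsilon)\big]=O\Big(\frac1{mn^\lambda}+\frac1{n^{2\lambda}}\Big),$$ where the implied constants do not depend on $n$ and $m$ (the problem data, $\epsilon$, $\lambda$, $K$ being fixed).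
   Context: $\tilde\xi$ is a random vector on a probability space with values in $\Xi\subset\mathbb R^d$. $X\subset\mathbb R^p$ is a nonempty compact convex set contained in a cube of edge length $D$; $D_X=\max_{x,x'\in X}\|x-x'\|$, with $\|\cdot\|$ the Euclidean norm. $F:X\times\Xi\to\mathbb R$ is a Carathéodory function (continuous in $x$, measurable in $\xi$) such that: (i) for some $L_F$ and $\gamma\in(0,1]$, $|F(x,\xi)-F(y,\xi)|\le L_F\|x-y\|^\gamma$ for all $x,y\in X$, $\xi\in\Xi$; (ii) for some $M_F\in(0,\infty)$, $\sup_{x\in X,\xi\in\Xi}|F(x,\xi)|<M_F$; (iii) $F(\cdot,\xi)$ is convex on $X$ for every $\xi\in\Xi$. True problem: $f(x)=\mathbb E[F(x,\tilde\xi)]$, $\theta^*=\min_{x\in X}f(x)$, $X^*_\epsilon=\{x\in X:f(x)\le\theta^*+\epsilon\}$. Sampling: $\tilde\xi_1,\dots,\tilde\xi_N$ ($N=mn$) are i.i.d. copies of $\tilde\xi$; $\tilde\xi^N$ is the whole sample and $\tilde\xi^n_i=\{\tilde\xi_{(i-1)n+1},\dots,\tilde\xi_{in}\}$ the sample of replication $i$; untilded symbols are realizations. $f_n(x;\xi^n_i)=\frac1n\sum_{j=1}^nF(x,\xi_{(i-1)n+j})$. Inexact compromise decision problem: for each $i$, $x_{n,\epsilon}(\xi^n_i)$ is a chosen element of $X_{n,\epsilon}(\xi^n_i)=\{x\in X:f_n(x;\xi^n_i)\le\min_{x'\in X}f_n(x';\xi^n_i)+\epsilon\}$. With $\bar f_N(x;\xi^N)=\frac1m\sum_{i=1}^mf_n(x;\xi^n_i)$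 and $$\theta_{N,\rho,\epsilon}(\xi^N)=\min_{x\in X}\bar f_N(x;\xi^N)+\frac\rho2\Big\|x-\frac1m\sum_{i=1}^mx_{n,\epsilon}(\xi^n_i)\Big\|^2,$$ $$\hat X_{N,\rho,\epsilon}(\xi^N)=\Big\{x\in X:\bar f_N(x;\xi^N)+\frac\rho2\Big\|x-\frac1m\sum_{i=1}^mx_{n,\epsilon}(\xi^n_i)\Big\|^2\le\theta_{N,\rho,\epsilon}(\xi^N)+\epsilon\Big\}.$$ Pessimistic distance: $\Delta(A,B)=\sup_{a\in A}\inf_{b\in B}\|a-b\|$. Constant: $N_F=L_FD^\gamma p^{\gamma/2}+M_F\sqrt{2\log2}+\dfrac{M_Fp^{1/2}}{\sqrt{\gamma(1-2\lambda)e}}$. All selections and random quantities whose expectation or variance is taken are assumed measurable. *)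

theory Defs
  imports "HOL-Probability.Probability"
begin

text \<open>
  Decisions live in \<open>real ^ 'p\<close>, so the dimension of the decision space is \<open>CARD('p)\<close>; random
  vectors take values in a set \<open>\<Xi>\<close> of \<open>real ^ 'd\<close>, which carries the trace
  \<open>restrict_space borel \<Xi>\<close> of the Borel sigma-algebra. A random variable into that measure space
  takes its values in \<open>\<Xi>\<close>.
\<close>

text \<open>A cube of edge length \<open>D\<close>, not necessarily parallel to the coordinate axes.\<close>

definition contained_in_cube :: "(real ^ 'p) set \<Rightarrow> real \<Rightarrow> bool" where
  "contained_in_cube X D \<longleftrightarrow>
     (\<exists>(T :: real ^ 'p \<Rightarrow> real ^ 'p) a. orthogonal_transformation T \<and> X \<subseteq> T ` {x. \<forall>i. a $ i \<le> x $ i \<and> x $ i \<le> a $ i + D})"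

definition caratheodory ::
  "(real ^ 'p) set \<Rightarrow> (real ^ 'd) set \<Rightarrow> (real ^ 'p \<Rightarrow> real ^ 'd \<Rightarrow> real) \<Rightarrow> bool" where
  "caratheodory X \<Xi> F \<longleftrightarrow>
     (\<forall>\<xi>\<in>\<Xi>. continuous_on X (\<lambda>x. F x \<xi>)) \<and>
     (\<forall>x\<in>X. F x \<in> borel_measurable (restrict_space borel \<Xi>))"

text \<open>
  Every minimum below is that of a continuous function over a nonempty compact set, so it is
  attained and equals the infimum.
\<close>

definition min_value :: "'a set \<Rightarrow> ('a \<Rightarrow> real) \<Rightarrow> real" where
  "min_value X g = (INF x\<in>X. g x)"

definition eps_solutions :: "'a set \<Rightarrow> ('a \<Rightarrow> real) \<Rightarrow> real \<Rightarrow> 'a set" where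
  "eps_solutions X g \<epsilon> = {x \<in> X. g x \<le> min_value X g + \<epsilon>}"

definition pess_dist :: "'a::real_normed_vector set \<Rightarrow> 'a set \<Rightarrow> real" where
  "pess_dist A B = (SUP a\<in>A. INF b\<in>B. norm (a - b))"

definition true_obj ::
  "'w measure \<Rightarrow> ('w \<Rightarrow> real ^ 'd) \<Rightarrow> (real ^ 'p \<Rightarrow> real ^ 'd \<Rightarrow> real) \<Rightarrow> real ^ 'p \<Rightarrow> real" where
  "true_obj M \<xi> F x = prob_space.expectation M (\<lambda>\<omega>. F x (\<xi> \<omega>))"

definition iid_copies ::
  "'w measure \<Rightarrow> (real ^ 'd) set \<Rightarrow> ('w \<Rightarrow> real ^ 'd) \<Rightarrow> nat \<Rightarrow> (nat \<Rightarrow> 'w \<Rightarrow> real ^ 'd) \<Rightarrow> bool" where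
  "iid_copies M \<Xi> \<xi> N S \<longleftrightarrow>
     prob_space.indep_vars M (\<lambda>_. restrict_space borel \<Xi>) S {1..N} \<and>
     (\<forall>k\<in>{1..N}. distr M (restrict_space borel \<Xi>) (S k) = distr M (restrict_space borel \<Xi>) \<xi>)"

text \<open>
  A realization of a sample of size \<open>N\<close> is a function on \<open>{1..N}\<close>. The restriction to \<open>{1..n}\<close>
  keeps anything computed from one replication from depending on the other replications.
\<close>

definition replication :: "nat \<Rightarrow> (nat \<Rightarrow> 'b) \<Rightarrow> nat \<Rightarrow> nat \<Rightarrow> 'b" where
  "replication n s i = (\<lambda>j\<in>{1..n}. s ((i - 1) * n + j))"

definition saa_obj ::
  "(real ^ 'p \<Rightarrow> real ^ 'd \<Rightarrow> real) \<Rightarrow> nat \<Rightarrow> (nat \<Rightarrow> real ^ 'd) \<Rightarrow> real ^ 'p \<Rightarrow> real" where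
  "saa_obj F n z x = (1 / real n) * (\<Sum>j=1..n. F x (z j))"

definition eps_selection ::
  "(real ^ 'p) set \<Rightarrow> (real ^ 'd) set \<Rightarrow> (real ^ 'p \<Rightarrow> real ^ 'd \<Rightarrow> real) \<Rightarrow> nat \<Rightarrow> real \<Rightarrow>
   ((nat \<Rightarrow> real ^ 'd) \<Rightarrow> real ^ 'p) \<Rightarrow> bool" where
  "eps_selection X \<Xi> F n \<epsilon> sel \<longleftrightarrow>
     sel \<in> borel_measurable (Pi\<^sub>M {1..n} (\<lambda>_. restrict_space borel \<Xi>)) \<and>
     (\<forall>z \<in> {1..n} \<rightarrow>\<^sub>E \<Xi>. sel z \<in> eps_solutions X (saa_obj F n z) \<epsilon>)"

text \<open>\<open>sel i\<close> is the selection used in replication \<open>i\<close>.\<close>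

definition compromise_obj ::
  "(real ^ 'p \<Rightarrow> real ^ 'd \<Rightarrow> real) \<Rightarrow> nat \<Rightarrow> nat \<Rightarrow> real \<Rightarrow>
   (nat \<Rightarrow> (nat \<Rightarrow> real ^ 'd) \<Rightarrow> real ^ 'p) \<Rightarrow> (nat \<Rightarrow> real ^ 'd) \<Rightarrow> real ^ 'p \<Rightarrow> real" where
  "compromise_obj F m n \<rho> sel s x =
     (1 / real m) * (\<Sum>i=1..m. saa_obj F n (replication n s i) x) +
     \<rho> / 2 * (norm (x - (1 / real m) *\<^sub>R (\<Sum>i=1..m. sel i (replication n s i))))\<^sup>2"

definition compromise_dist ::
  "'w measure \<Rightarrow> (real ^ 'p) set \<Rightarrow> ('w \<Rightarrow> real ^ 'd) \<Rightarrow> (real ^ 'p \<Rightarrow> real ^ 'd \<Rightarrow> real) \<Rightarrow>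
   nat \<Rightarrow> nat \<Rightarrow> real \<Rightarrow> real \<Rightarrow> (nat \<Rightarrow> (nat \<Rightarrow> real ^ 'd) \<Rightarrow> real ^ 'p) \<Rightarrow>
   (nat \<Rightarrow> 'w \<Rightarrow> real ^ 'd) \<Rightarrow> 'w \<Rightarrow> real" where
  "compromise_dist M X \<xi> F m n \<rho> \<epsilon> sel S \<omega> =
     pess_dist (eps_solutions X (compromise_obj F m n \<rho> sel (\<lambda>k. S k \<omega>)) \<epsilon>)
               (eps_solutions X (true_obj M \<xi> F) \<epsilon>)"

definition N_F :: "real \<Rightarrow> real \<Rightarrow> real \<Rightarrow> nat \<Rightarrow> real \<Rightarrow> real \<Rightarrow> real" where
  "N_F L \<gamma> D p M\<^sub>F l =
     L * D powr \<gamma> * real p powr (\<gamma> / 2) + M\<^sub>F * sqrt (2 * ln 2) +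
     M\<^sub>F * sqrt (real p) / sqrt (\<gamma> * (1 - 2 * l) * exp 1)"

end

theory Submission
  imports Defs
begin

text \<open>
  Let \<open>\<delta>\<^sub>i\<close> bound the uniform deviation of the \<open>i\<close>-th sample average from the true objective. By
  convexity the distance to the true \<open>\<epsilon>\<close>-solutions is at most \<open>4 * D\<^sub>X / \<epsilon>\<close> times the average of
  the \<open>\<delta>\<^sub>i\<close>, plus \<open>2 * sqrt (\<epsilon> / \<rho>)\<close>. Taking for \<open>\<delta>\<^sub>i\<close> the maximal deviation over a finite net of
  \<open>X\<close> plus a Hoelder error avoids all measurability questions for suprema, and Hoeffding's lemma
  bounds its mean by \<open>2 * N\<^sub>F / n powr \<lambda>\<close> without symmetrization. The \<open>\<delta>\<^sub>i\<close> are independent and,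
  up to the constant, bounded by \<open>2 * M\<^sub>F\<close>, so the variance of their average is of order \<open>1 / m\<close>
  times that mean; the variance of the distance is at most its second moment.
\<close>

text \<open>Variance is not monotone, so a pointwise bound on the distance says nothing about its
  variance. Second moments are monotone. This is why the bound on the mean reappears squared in the
  conclusion, next to the term of order \<open>1 / m\<close>. The constants arise as follows. In the
  factor 4, one 2 is the loss of optimality of the averaged selection and the other 2 comes from
  comparing the averaged sample objective with the true one at two points. The 2 in front of
  \<open>N_F\<close> is there because the Hoelder error of the net enters twice, through the sample
  average and through the true objective. The mean therefore carries 8 = 4 * 2, and the variance 64
  = 16 * 2 * 2: the squared factor 4, the range \<open>2 * M\<^sub>F\<close> and the 2 in front of
  \<open>N_F\<close>. The summand of \<open>N_F\<close> containing \<open>exp 1\<close> is the price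
  of replacing the logarithm of the size of the net by a power of \<open>n\<close>.\<close>

section \<open>Near-optimal sets of convex functions\<close>

text \<open>Slide \<open>x\<close> towards an almost minimizer \<open>y\<close>. By convexity the
  value drops at least as fast as along the chord, so at most the fraction
  \<open>s / \<epsilon>\<close> of the way sheds the excess \<open>s\<close>.\<close>

lemma near_eps_solution:
  fixes X :: "'a::real_normed_vector set"
  assumes "bounded X" "convex_on X f" and bdd: "bdd_below (f ` X)"
    and "0 < \<epsilon>" "0 \<le> s" "x \<in> X" and fx: "f x \<le> min_value X f + \<epsilon> + s"
  obtains y where "y \<in> eps_solutions X f \<epsilon>" "norm (x - y) \<le> diameter X * s / \<epsilon>"
proof (cases "s = 0")
  case True
  then show ?thesis
    using that[of x] assms by (auto simp: eps_solutions_def)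
next
  case False
  with \<open>0 \<le> s\<close> have "0 < s" by simp
  define \<theta> where "\<theta> = min_value X f"
  \<comment> \<open>The infimum need not be attained, so \<open>y\<close> is only optimal up to
    \<open>\<eta>\<close>. Below, \<open>\<eta> \<le> s\<close> yields
    \<open>t \<le> s / \<epsilon>\<close>, and \<open>\<eta> \<le> \<epsilon>\<close> yields
    \<open>t \<le> 1\<close>.\<close>
  define \<eta> where "\<eta> = min s \<epsilon>"
  have \<eta>: "0 < \<eta>" "\<eta> \<le> s" "\<eta> \<le> \<epsilon>"
    using \<open>0 < s\<close> \<open>0 < \<epsilon>\<close> by (auto simp: \<eta>_def)
  have "(INF x\<in>X. f x) < \<theta> + \<eta>"
    using \<eta> by (simp add: \<theta>_def min_value_def)
  then obtain y where y: "y \<in> X" "f y < \<theta> + \<eta>"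
    using cINF_less_iff[OF _ bdd] \<open>x \<in> X\<close> by blast
  \<comment> \<open>This \<open>t\<close> makes the chord bound
    \<open>\<theta> + \<epsilon> + s - t * (\<epsilon> + s - \<eta>)\<close> equal to
    \<open>\<theta> + \<epsilon>\<close>.\<close>
  define t where "t = s / (\<epsilon> + s - \<eta>)"
  define w where "w = (1 - t) *\<^sub>R x + t *\<^sub>R y"
  have t: "0 \<le> t" "t \<le> 1" "t \<le> s / \<epsilon>"
    using \<eta> \<open>0 < s\<close> \<open>0 < \<epsilon>\<close> by (auto simp: t_def divide_simps intro!: mult_left_mono)
  have teq: "t * (\<epsilon> + s - \<eta>) = s"
    using \<eta> \<open>0 < s\<close> \<open>0 < \<epsilon>\<close> by (simp add: t_def)
  have "w \<in> X"
    unfolding w_def using convex_on_imp_convex[OF assms(2)] t y \<open>x \<in> X\<close>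
    by (intro convexD) auto
  moreover have "f w \<le> \<theta> + \<epsilon>"
  proof -
    have "f w \<le> (1 - t) * f x + t * f y"
      unfolding w_def using convex_onD[OF assms(2)] t y \<open>x \<in> X\<close> by blast
    also have "\<dots> \<le> (1 - t) * (\<theta> + \<epsilon> + s) + t * (\<theta> + \<eta>)"
      using t y fx by (intro add_mono mult_left_mono) (auto simp: \<theta>_def)
    also have "\<dots> = \<theta> + \<epsilon> + s - t * (\<epsilon> + s - \<eta>)"
      by (simp add: algebra_simps)
    finally show ?thesis using teq by simp
  qed
  ultimately have "w \<in> eps_solutions X f \<epsilon>"
    by (simp add: eps_solutions_def \<theta>_def)
  moreover have "norm (x - w) \<le> diameter X * s / \<epsilon>"
  proof -
    have "x - w = t *\<^sub>R (x - y)"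
      by (simp add: w_def algebra_simps)
    then have "norm (x - w) = t * norm (x - y)"
      using t by simp
    also have "\<dots> \<le> s / \<epsilon> * diameter X"
      using t diameter_bounded_bound[OF \<open>bounded X\<close> \<open>x \<in> X\<close> y(1)] \<open>0 < s\<close> \<open>0 < \<epsilon>\<close>
      by (intro mult_mono) (auto simp: dist_norm)
    finally show ?thesis by (simp add: mult.commute)
  qed
  ultimately show ?thesis by (rule that)
qed

text \<open>Real \<open>SUP\<close> and \<open>INF\<close> carry information only for nonempty
  bounded families. The witnesses \<open>b\<close> provide this: they make \<open>B\<close> nonempty
  and bound the inner infima from above by \<open>c\<close>.\<close>

lemma pess_dist_bounds:
  assumes "A \<noteq> {}" and B: "\<And>a. a \<in> A \<Longrightarrow> \<exists>b\<in>B. norm (a - b) \<le> c"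
  shows "0 \<le> pess_dist A B" "pess_dist A B \<le> c"
proof -
  define h where "h a = (INF b\<in>B. norm (a - b))" for a
  obtain a where a: "a \<in> A" using \<open>A \<noteq> {}\<close> by blast
  have upper: "h x \<le> c" if "x \<in> A" for x
  proof -
    obtain b where "b \<in> B" "norm (x - b) \<le> c" using B[OF \<open>x \<in> A\<close>] by blast
    then show ?thesis
      unfolding h_def by (intro cINF_lower2[of _ B b]) (auto intro!: bdd_belowI2[where m = 0])
  qed
  have "0 \<le> h a"
    unfolding h_def using B[OF a] by (intro cINF_greatest) auto
  also have "h a \<le> (SUP x\<in>A. h x)"
    using a upper by (intro cSUP_upper bdd_aboveI2) auto
  finally show "0 \<le> pess_dist A B" by (simp add: pess_dist_def h_def)
  show "pess_dist A B \<le> c"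
    unfolding pess_dist_def using \<open>A \<noteq> {}\<close> upper by (intro cSUP_least) (auto simp: h_def)
qed

text \<open>
  An \<open>\<epsilon>\<close>-solution \<open>x\<close> either decreases the averaged objective by less than \<open>\<epsilon>\<close> relative to the
  averaged selection, so the proximal term keeps it within \<open>2 * sqrt (\<epsilon> / \<rho>)\<close> of it, or by at
  least \<open>\<epsilon>\<close>, so \<open>x\<close> inherits the near optimality of the averaged selection.
\<close>
lemma compromise_pess_dist:
  fixes X :: "'a::real_normed_vector set" and g :: "nat \<Rightarrow> 'a \<Rightarrow> real" and y :: "nat \<Rightarrow> 'a"
  assumes "bounded X" "convex_on X f" and bdd: "bdd_below (f ` X)"
    and "0 < \<epsilon>" "0 < \<rho>" "0 < m"
    and close: "\<And>i x. i \<in> {1..m} \<Longrightarrow> x \<in> X \<Longrightarrow> \<bar>g i x - f x\<bar> \<le> d i"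
    and y: "\<And>i. i \<in> {1..m} \<Longrightarrow> y i \<in> eps_solutions X (g i) \<epsilon>"
  defines "\<phi> \<equiv> \<lambda>x. (1 / real m) * (\<Sum>i=1..m. g i x) +
      \<rho> / 2 * (norm (x - (1 / real m) *\<^sub>R (\<Sum>i=1..m. y i)))\<^sup>2"
    and "c \<equiv> 4 * diameter X / \<epsilon> * ((1 / real m) * (\<Sum>i=1..m. d i)) + 2 * sqrt (\<epsilon> / \<rho>)"
  shows "0 \<le> pess_dist (eps_solutions X \<phi> \<epsilon>) (eps_solutions X f \<epsilon>)"
    and "pess_dist (eps_solutions X \<phi> \<epsilon>) (eps_solutions X f \<epsilon>) \<le> c"
proof -
  define \<theta> where "\<theta> = min_value X f"
  define G where "G x = (1 / real m) * (\<Sum>i=1..m. g i x)" for x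
  define z where "z = (1 / real m) *\<^sub>R (\<Sum>i=1..m. y i)"
  define \<delta> where "\<delta> = (1 / real m) * (\<Sum>i=1..m. d i)"
  have \<phi>: "\<phi> x = G x + \<rho> / 2 * (norm (x - z))\<^sup>2" for x
    by (simp add: \<phi>_def G_def z_def)
  have yX: "y i \<in> X" if "i \<in> {1..m}" for i
    using y[OF that] by (simp add: eps_solutions_def)
  have \<theta>_le: "\<theta> \<le> f x" if "x \<in> X" for x
    unfolding \<theta>_def min_value_def using bdd that by (rule cINF_lower)
  have "1 \<in> {1..m}" using \<open>0 < m\<close> by simp
  have "0 \<le> \<delta>"
    unfolding \<delta>_def using close yX[OF \<open>1 \<in> {1..m}\<close>]
    by (intro mult_nonneg_nonneg sum_nonneg) (force intro: order_trans[OF abs_ge_zero])+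
  have G_close: "\<bar>G x - f x\<bar> \<le> \<delta>" if "x \<in> X" for x
  proof -
    have "G x - f x = (1 / real m) * (\<Sum>i=1..m. g i x - f x)"
      using \<open>0 < m\<close> by (simp add: G_def sum_subtractf field_simps)
    also have "\<bar>\<dots>\<bar> \<le> (1 / real m) * (\<Sum>i=1..m. \<bar>g i x - f x\<bar>)"
      by (simp add: abs_mult divide_right_mono sum_abs)
    also have "\<dots> \<le> \<delta>"
      unfolding \<delta>_def using close that by (intro mult_left_mono sum_mono) auto
    finally show ?thesis .
  qed
  \<comment> \<open>Closeness is used twice, at \<open>y i\<close> and to compare the two infima;
    hence \<open>2 * d i\<close>.\<close>
  have fy: "f (y i) \<le> \<theta> + \<epsilon> + 2 * d i" if i: "i \<in> {1..m}" for i
  proof -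
    have "bdd_below (g i ` X)"
    proof (rule bdd_belowI2)
      show "\<theta> - d i \<le> g i x" if "x \<in> X" for x
        using close[OF i that] \<theta>_le[OF that] by linarith
    qed
    have "min_value X (g i) - d i \<le> \<theta>"
      unfolding \<theta>_def min_value_def
    proof (rule cINF_greatest)
      show "X \<noteq> {}" using yX[OF i] by blast
      show "(INF x\<in>X. g i x) - d i \<le> f x" if "x \<in> X" for x
        using cINF_lower[OF \<open>bdd_below (g i ` X)\<close> that] close[OF i that] by linarith
    qed
    then show ?thesis
      using y[OF i] close[OF i yX[OF i]] by (auto simp: eps_solutions_def)
  qed
  have z: "z = (\<Sum>i=1..m. (1 / real m) *\<^sub>R y i)"
    by (simp add: z_def scaleR_sum_right)
  have "z \<in> X"
    unfolding z using \<open>0 < m\<close> yX convex_on_imp_convex[OF assms(2)] by (intro convex_sum) auto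
  \<comment> \<open>Jensen's inequality passes the near optimality of the selections to their
    average.\<close>
  have "f z \<le> (\<Sum>i=1..m. (1 / real m) * f (y i))"
    unfolding z using \<open>0 < m\<close> yX by (intro convex_on_sum[OF _ _ assms(2)]) auto
  also have "\<dots> \<le> (\<Sum>i=1..m. (1 / real m) * (\<theta> + \<epsilon> + 2 * d i))"
    using fy by (intro sum_mono mult_left_mono) auto
  also have "\<dots> = (1 / real m) * (\<Sum>i=1..m. \<theta> + \<epsilon> + 2 * d i)"
    by (simp only: sum_distrib_left)
  also have "\<dots> = \<theta> + \<epsilon> + 2 * \<delta>"
    using \<open>0 < m\<close> by (simp add: \<delta>_def sum.distrib field_simps sum_distrib_left)
  finally have fz: "f z \<le> \<theta> + \<epsilon> + 2 * \<delta>" .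
  have diam: "0 \<le> diameter X"
    using \<open>bounded X\<close> by (rule diameter_ge_0)
  have \<phi>_bdd: "bdd_below (\<phi> ` X)"
  proof (rule bdd_belowI2)
    show "\<theta> - \<delta> \<le> \<phi> x" if "x \<in> X" for x
      using G_close[OF that] \<theta>_le[OF that] \<open>0 < \<rho>\<close> mult_nonneg_nonneg[of "\<rho> / 2" "(norm (x - z))\<^sup>2"]
      unfolding \<phi> by (smt (verit) zero_le_power2 half_gt_zero)
  qed
  have near: "\<exists>b\<in>eps_solutions X f \<epsilon>. norm (x - b) \<le> c" if x: "x \<in> eps_solutions X \<phi> \<epsilon>" for x
  proof -
    have "x \<in> X" using x by (simp add: eps_solutions_def)
    have "\<phi> x \<le> \<phi> z + \<epsilon>"
      using x cINF_lower[OF \<phi>_bdd \<open>z \<in> X\<close>] by (simp add: eps_solutions_def min_value_def)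
    then have x_le: "G x + \<rho> / 2 * (norm (x - z))\<^sup>2 \<le> G z + \<epsilon>"
      by (simp add: \<phi>)
    show ?thesis
    proof (cases "G z - \<epsilon> \<le> G x")
      case True
      with x_le have "\<rho> / 2 * (norm (x - z))\<^sup>2 \<le> 2 * \<epsilon>" by simp
      then have "(norm (x - z))\<^sup>2 \<le> 4 * (\<epsilon> / \<rho>)"
        using \<open>0 < \<rho>\<close> by (simp add: field_simps)
      then have "norm (x - z) \<le> sqrt (4 * (\<epsilon> / \<rho>))"
        by (rule real_le_rsqrt)
      then have 1: "norm (x - z) \<le> 2 * sqrt (\<epsilon> / \<rho>)"
        by (simp only: real_sqrt_mult real_sqrt_four)
      have "0 \<le> 2 * \<delta>" using \<open>0 \<le> \<delta>\<close> by simp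
      then obtain b where b: "b \<in> eps_solutions X f \<epsilon>" "norm (z - b) \<le> diameter X * (2 * \<delta>) / \<epsilon>"
        using near_eps_solution[OF assms(1,2,3) \<open>0 < \<epsilon>\<close> _ \<open>z \<in> X\<close>] fz unfolding \<theta>_def by blast
      have "diameter X * (2 * \<delta>) / \<epsilon> \<le> 4 * diameter X / \<epsilon> * \<delta>"
        using diam \<open>0 \<le> \<delta>\<close> \<open>0 < \<epsilon>\<close> by (simp add: divide_simps mult_ac)
      then have "norm (x - b) \<le> c"
        using 1 b(2) norm_triangle_ineq[of "x - z" "z - b"] unfolding c_def \<delta>_def by simp
      then show ?thesis using b(1) by blast
    next
      case False
      \<comment> \<open>Going from \<open>f x\<close> to \<open>G x\<close> and from
        \<open>G z\<close> to \<open>f z\<close> costs \<open>2 * \<delta>\<close>, and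
        \<open>fz\<close> contributes another \<open>2 * \<delta>\<close>.\<close>
      then have "f x \<le> \<theta> + \<epsilon> + 4 * \<delta>"
        using G_close[OF \<open>x \<in> X\<close>] G_close[OF \<open>z \<in> X\<close>] fz \<open>0 < \<epsilon>\<close> by linarith
      moreover have "0 \<le> 4 * \<delta>" using \<open>0 \<le> \<delta>\<close> by simp
      ultimately obtain b where b: "b \<in> eps_solutions X f \<epsilon>" "norm (x - b) \<le> diameter X * (4 * \<delta>) / \<epsilon>"
        using near_eps_solution[OF assms(1,2,3) \<open>0 < \<epsilon>\<close> _ \<open>x \<in> X\<close>] unfolding \<theta>_def by blast
      have "norm (x - b) \<le> 4 * diameter X / \<epsilon> * \<delta>"
        using b(2) by (simp add: mult_ac)
      also have "\<dots> \<le> c"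
        using \<open>0 < \<epsilon>\<close> \<open>0 < \<rho>\<close> by (simp add: c_def \<delta>_def)
      finally show ?thesis using b(1) by blast
    qed
  qed
  have "(INF x\<in>X. \<phi> x) < min_value X \<phi> + \<epsilon>"
    using \<open>0 < \<epsilon>\<close> by (simp add: min_value_def)
  then obtain x where "x \<in> X" "\<phi> x < min_value X \<phi> + \<epsilon>"
    using cINF_less_iff[OF _ \<phi>_bdd] \<open>z \<in> X\<close> by blast
  then have "eps_solutions X \<phi> \<epsilon> \<noteq> {}"
    by (auto simp: eps_solutions_def intro!: exI[of _ x])
  from pess_dist_bounds[OF this near]
  show "0 \<le> pess_dist (eps_solutions X \<phi> \<epsilon>) (eps_solutions X f \<epsilon>)"
    and "pess_dist (eps_solutions X \<phi> \<epsilon>) (eps_solutions X f \<epsilon>) \<le> c"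
    by blast+
qed

section \<open>Expected maxima of sub-Gaussian deviations\<close>

text \<open>Positive \<open>t\<close> is the library inequality for nonnegative integrals. Negative
  \<open>t\<close> is the same inequality for \<open>- f\<close> on the reflected interval, which
  has the same width. Both signs are needed to control absolute deviations.\<close>

lemma (in interval_bounded_random_variable) Hoeffdings_lemma:
  fixes t :: real
  defines "\<mu> \<equiv> expectation f"
  shows "integrable M (\<lambda>\<omega>. exp (t * (f \<omega> - \<mu>)))"
    and "expectation (\<lambda>\<omega>. exp (t * (f \<omega> - \<mu>))) \<le> exp (t\<^sup>2 * (b - a)\<^sup>2 / 8)"
proof -
  have int: "integrable M (\<lambda>\<omega>. exp (t * (f \<omega> - \<mu>)))"
  proof (rule integrable_const_bound)
    show "AE \<omega> in M. norm (exp (t * (f \<omega> - \<mu>))) \<le> exp (\<bar>t\<bar> * (\<bar>a\<bar> + \<bar>b\<bar> + \<bar>\<mu>\<bar>))"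
    proof (rule eventually_mono[OF AE_in_interval])
      fix \<omega> assume "f \<omega> \<in> {a..b}"
      then have "\<bar>f \<omega> - \<mu>\<bar> \<le> \<bar>a\<bar> + \<bar>b\<bar> + \<bar>\<mu>\<bar>" by auto
      then have "\<bar>t\<bar> * \<bar>f \<omega> - \<mu>\<bar> \<le> \<bar>t\<bar> * (\<bar>a\<bar> + \<bar>b\<bar> + \<bar>\<mu>\<bar>)"
        by (intro mult_left_mono) auto
      then show "norm (exp (t * (f \<omega> - \<mu>))) \<le> exp (\<bar>t\<bar> * (\<bar>a\<bar> + \<bar>b\<bar> + \<bar>\<mu>\<bar>))"
        using abs_ge_self[of "t * (f \<omega> - \<mu>)"] by (simp add: abs_mult)
    qed
  qed simp
  then show "integrable M (\<lambda>\<omega>. exp (t * (f \<omega> - \<mu>)))" .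
  have "(\<integral>\<^sup>+\<omega>. exp (t * (f \<omega> - \<mu>)) \<partial>M) \<le> ennreal (exp (t\<^sup>2 * (b - a)\<^sup>2 / 8))"
  proof (cases t "0 :: real" rule: linorder_cases)
    case less
    interpret neg: interval_bounded_random_variable M "\<lambda>\<omega>. - f \<omega>" "- b" "- a"
      by unfold_locales (auto intro!: eventually_mono[OF AE_in_interval])
    show ?thesis
      using neg.Hoeffdings_lemma_nn_integral[of "- t"] less by (simp add: \<mu>_def algebra_simps)
  next
    case equal
    then show ?thesis by (simp add: emeasure_space_1)
  next
    case greater
    then show ?thesis
      using Hoeffdings_lemma_nn_integral[of t] by (simp add: \<mu>_def)
  qed
  then show "expectation (\<lambda>\<omega>. exp (t * (f \<omega> - \<mu>))) \<le> exp (t\<^sup>2 * (b - a)\<^sup>2 / 8)"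
    by (subst (asm) nn_integral_eq_integral[OF int]) auto
qed

text \<open>
  The bound integrates the pointwise inequality \<open>t * u \<le> exp (t * u) / A - 1 + ln A\<close>, where
  \<open>A = 2 * card V * exp (t\<^sup>2 * \<sigma>\<^sup>2 / 2)\<close> and \<open>t\<close> minimizes the outcome \<open>ln A / t\<close>.
\<close>
lemma (in prob_space) expectation_Max_abs_subgaussian:
  fixes Y :: "'v \<Rightarrow> 'a \<Rightarrow> real"
  assumes V: "finite V" "V \<noteq> {}" and "0 < \<sigma>"
    and int: "\<And>v t. v \<in> V \<Longrightarrow> integrable M (\<lambda>\<omega>. exp (t * Y v \<omega>))"
    and mgf: "\<And>v t. v \<in> V \<Longrightarrow> expectation (\<lambda>\<omega>. exp (t * Y v \<omega>)) \<le> exp (t\<^sup>2 * \<sigma>\<^sup>2 / 2)"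
  shows "expectation (\<lambda>\<omega>. MAX v\<in>V. \<bar>Y v \<omega>\<bar>) \<le> \<sigma> * sqrt (2 * ln (2 * real (card V)))"
proof -
  \<comment> \<open>The sum \<open>B\<close> below has \<open>k\<close> exponentials: each absolute
    value is the larger of \<open>Y v\<close> and its negative.\<close>
  define k where "k = 2 * real (card V)"
  have "1 \<le> card V"
    using V by (simp add: Suc_le_eq card_gt_0_iff)
  then have "2 \<le> k" by (simp add: k_def)
  then have "0 < ln k" by simp
  define t where "t = sqrt (2 * ln k) / \<sigma>"
  have "0 < t" using \<open>0 < ln k\<close> \<open>0 < \<sigma>\<close> by (simp add: t_def)
  \<comment> \<open>\<open>A\<close> bounds the mean of \<open>B\<close>, so
    \<open>B / A - 1\<close> has nonpositive mean and only \<open>ln A / t\<close> survives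
    integration.\<close>
  define A where "A = k * exp (t\<^sup>2 * \<sigma>\<^sup>2 / 2)"
  have "0 < A" using \<open>2 \<le> k\<close> by (simp add: A_def)
  define B where "B \<omega> = (\<Sum>v\<in>V. exp (t * Y v \<omega>) + exp (- t * Y v \<omega>))" for \<omega>
  have int': "integrable M (\<lambda>\<omega>. exp (- t * Y v \<omega>))" if "v \<in> V" for v
    using int[OF that] .
  have intB: "integrable M B"
    unfolding B_def using int int' by (intro Bochner_Integration.integrable_sum Bochner_Integration.integrable_add) auto
  have "expectation B = (\<Sum>v\<in>V. expectation (\<lambda>\<omega>. exp (t * Y v \<omega>)) + expectation (\<lambda>\<omega>. exp (- t * Y v \<omega>)))"
    unfolding B_def using int int'
    by (subst Bochner_Integration.integral_sum)
       (auto intro!: sum.cong Bochner_Integration.integral_add Bochner_Integration.integrable_add)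
  also have "\<dots> \<le> (\<Sum>v\<in>V. exp (t\<^sup>2 * \<sigma>\<^sup>2 / 2) + exp (t\<^sup>2 * \<sigma>\<^sup>2 / 2))"
    using mgf[of _ t] mgf[of _ "- t"] by (intro sum_mono add_mono) auto
  also have "\<dots> = A" by (simp add: A_def k_def)
  finally have EB: "expectation B \<le> A" .
  have pointwise: "(MAX v\<in>V. \<bar>Y v \<omega>\<bar>) \<le> (B \<omega> / A - 1 + ln A) / t" for \<omega>
  proof -
    define u where "u = (MAX v\<in>V. \<bar>Y v \<omega>\<bar>)"
    have "u \<in> (\<lambda>v. \<bar>Y v \<omega>\<bar>) ` V"
      unfolding u_def using V by (intro Max_in) auto
    then obtain v where v: "v \<in> V" "u = \<bar>Y v \<omega>\<bar>" by blast
    have "exp (t * u) \<le> exp (t * Y v \<omega>) + exp (- t * Y v \<omega>)"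
      unfolding v(2) by (cases "0 \<le> Y v \<omega>") auto
    also have "\<dots> \<le> B \<omega>"
      unfolding B_def using v(1) V by (intro member_le_sum) (auto intro: add_nonneg_nonneg)
    finally have "exp (t * u) / A \<le> B \<omega> / A"
      using \<open>0 < A\<close> by (simp add: divide_right_mono)
    moreover have "exp (t * u - ln A) = exp (t * u) / A"
      using \<open>0 < A\<close> by (simp add: exp_diff)
    ultimately have "t * u \<le> B \<omega> / A - 1 + ln A"
      using exp_ge_add_one_self[of "t * u - ln A"] by linarith
    then show ?thesis
      using \<open>0 < t\<close> by (simp add: u_def field_simps)
  qed
  \<comment> \<open>\<open>integral_mono'\<close> asks for integrability of the upper bound alone,
    together with its nonnegativity: a function that is not integrable has integral 0 by
    convention.\<close>
  have "expectation (\<lambda>\<omega>. MAX v\<in>V. \<bar>Y v \<omega>\<bar>) \<le> expectation (\<lambda>\<omega>. (B \<omega> / A - 1 + ln A) / t)"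
  proof (rule integral_mono')
    show "integrable M (\<lambda>\<omega>. (B \<omega> / A - 1 + ln A) / t)" using intB by simp
    show "0 \<le> (B \<omega> / A - 1 + ln A) / t" for \<omega>
    proof -
      obtain v where "v \<in> V" using V by blast
      then have "\<bar>Y v \<omega>\<bar> \<le> (MAX v\<in>V. \<bar>Y v \<omega>\<bar>)" using V by (intro Max_ge) auto
      then show ?thesis using pointwise[of \<omega>] by (meson abs_ge_zero order_trans)
    qed
  qed (rule pointwise)
  also have "\<dots> = (expectation B / A - 1 + ln A) / t"
    using intB by (simp add: prob_space)
  also have "\<dots> \<le> ln A / t"
    using EB \<open>0 < A\<close> \<open>0 < t\<close> by (intro divide_right_mono) (auto simp: field_simps)
  also have "ln A = ln k + t\<^sup>2 * \<sigma>\<^sup>2 / 2"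
    using \<open>2 \<le> k\<close> by (simp add: A_def ln_mult)
  also have "t\<^sup>2 * \<sigma>\<^sup>2 = 2 * ln k"
    using \<open>0 < ln k\<close> \<open>0 < \<sigma>\<close> by (simp add: t_def power_divide)
  also have "(ln k + 2 * ln k / 2) / t = \<sigma> * (2 * ln k / sqrt (2 * ln k))"
    by (simp add: t_def)
  also have "\<dots> = \<sigma> * sqrt (2 * ln k)"
    using \<open>0 < ln k\<close> by (subst real_div_sqrt) auto
  finally show ?thesis by (simp add: k_def)
qed

text \<open>Independence over \<open>J\<close> factors the moment generating function of an average
  into \<open>card J\<close> Hoeffding factors of width \<open>2 * B\<close>, which makes the
  average sub-Gaussian with parameter \<open>B / sqrt (card J)\<close>. The rows \<open>Y v\<close>
  may depend on each other, as they will when all points of a net share one sample.\<close>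

lemma (in prob_space) expectation_Max_deviation_le:
  fixes Y :: "'v \<Rightarrow> 'j \<Rightarrow> 'a \<Rightarrow> real"
  assumes V: "finite V" "V \<noteq> {}" and J: "finite J" "J \<noteq> {}" and "0 < B"
    and indep: "\<And>v. v \<in> V \<Longrightarrow> indep_vars (\<lambda>_. borel) (Y v) J"
    and bound: "\<And>v j \<omega>. v \<in> V \<Longrightarrow> j \<in> J \<Longrightarrow> \<omega> \<in> space M \<Longrightarrow> \<bar>Y v j \<omega>\<bar> \<le> B"
    and mean: "\<And>v j. v \<in> V \<Longrightarrow> j \<in> J \<Longrightarrow> expectation (Y v j) = \<mu> v"
  shows "expectation (\<lambda>\<omega>. MAX v\<in>V. \<bar>(1 / real (card J)) * (\<Sum>j\<in>J. Y v j \<omega>) - \<mu> v\<bar>)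
    \<le> B / sqrt (card J) * sqrt (2 * ln (2 * real (card V)))"
proof (rule expectation_Max_abs_subgaussian[OF V])
  define n where "n = real (card J)"
  have "0 < n" using J by (simp add: n_def card_gt_0_iff)
  then show "0 < B / sqrt (card J)"
    using \<open>0 < B\<close> by (simp add: n_def)
  fix v t assume v: "v \<in> V"
  have eq: "exp (t * (1 / real (card J) * (\<Sum>j\<in>J. Y v j \<omega>) - \<mu> v))
      = (\<Prod>j\<in>J. exp (t / n * (Y v j \<omega> - \<mu> v)))" for \<omega>
  proof -
    have "t * (1 / real (card J) * (\<Sum>j\<in>J. Y v j \<omega>) - \<mu> v) = (\<Sum>j\<in>J. t / n * (Y v j \<omega> - \<mu> v))"
      using \<open>0 < n\<close> unfolding sum_distrib_left[symmetric]
      by (simp add: sum_subtractf n_def[symmetric] field_simps)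
    then show ?thesis using J by (simp add: exp_sum)
  qed
  have hoeffding: "integrable M (\<lambda>\<omega>. exp (t / n * (Y v j \<omega> - \<mu> v)))"
    "expectation (\<lambda>\<omega>. exp (t / n * (Y v j \<omega> - \<mu> v))) \<le> exp ((t / n)\<^sup>2 * (B - - B)\<^sup>2 / 8)"
    if j: "j \<in> J" for j
  proof -
    interpret Yj: interval_bounded_random_variable M "Y v j" "- B" B
    proof unfold_locales
      show "random_variable borel (Y v j)"
        using indep[OF v] j by (simp add: indep_vars_def)
      show "AE \<omega> in M. Y v j \<omega> \<in> {- B..B}"
        using bound[OF v j] by (intro AE_I2) (force simp: abs_le_iff)
    qed
    show "integrable M (\<lambda>\<omega>. exp (t / n * (Y v j \<omega> - \<mu> v)))"
      "expectation (\<lambda>\<omega>. exp (t / n * (Y v j \<omega> - \<mu> v))) \<le> exp ((t / n)\<^sup>2 * (B - - B)\<^sup>2 / 8)"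
      using Yj.Hoeffdings_lemma[of "t / n"] mean[OF v j] by simp_all
  qed
  have indep': "indep_vars (\<lambda>_. borel) (\<lambda>j \<omega>. exp (t / n * (Y v j \<omega> - \<mu> v))) J"
    by (rule indep_vars_compose2[OF indep[OF v]]) simp
  show "integrable M (\<lambda>\<omega>. exp (t * (1 / real (card J) * (\<Sum>j\<in>J. Y v j \<omega>) - \<mu> v)))"
    unfolding eq using J indep' hoeffding by (intro indep_vars_integrable) auto
  have "expectation (\<lambda>\<omega>. exp (t * (1 / real (card J) * (\<Sum>j\<in>J. Y v j \<omega>) - \<mu> v)))
      = (\<Prod>j\<in>J. expectation (\<lambda>\<omega>. exp (t / n * (Y v j \<omega> - \<mu> v))))"
    unfolding eq using J indep' hoeffding by (intro indep_vars_lebesgue_integral) auto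
  also have "\<dots> \<le> (\<Prod>j\<in>J. exp ((t / n)\<^sup>2 * (B - - B)\<^sup>2 / 8))"
    using hoeffding by (intro prod_mono) auto
  also have "\<dots> = exp (n * ((t / n)\<^sup>2 * (B - - B)\<^sup>2 / 8))"
    by (simp only: prod_constant n_def exp_of_nat_mult)
  also have "n * ((t / n)\<^sup>2 * (B - - B)\<^sup>2 / 8) = t\<^sup>2 * (B / sqrt (card J))\<^sup>2 / 2"
    using \<open>0 < n\<close> by (simp add: power_divide n_def[symmetric] power2_eq_square field_simps)
  finally show "expectation (\<lambda>\<omega>. exp (t * (1 / real (card J) * (\<Sum>j\<in>J. Y v j \<omega>) - \<mu> v)))
      \<le> exp (t\<^sup>2 * (B / sqrt (card J))\<^sup>2 / 2)" .
qed

section \<open>Second moments of averages of independent variables\<close>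

text \<open>Bienayme's identity. In the induction the new summand is independent of the partial sum,
  so the cross term factors and vanishes. The bound \<open>B\<close> makes all products
  integrable.\<close>

lemma (in prob_space) expectation_power2_sum_indep_vars:
  fixes Z :: "'i \<Rightarrow> 'a \<Rightarrow> real"
  assumes "finite I" "indep_vars (\<lambda>_. borel) Z I"
    and "\<And>i. i \<in> I \<Longrightarrow> expectation (Z i) = 0"
    and "\<And>i \<omega>. i \<in> I \<Longrightarrow> \<omega> \<in> space M \<Longrightarrow> \<bar>Z i \<omega>\<bar> \<le> B"
  shows "expectation (\<lambda>\<omega>. (\<Sum>i\<in>I. Z i \<omega>)\<^sup>2) = (\<Sum>i\<in>I. expectation (\<lambda>\<omega>. (Z i \<omega>)\<^sup>2))"
  using assms
proof (induction I rule: finite_induct)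
  case empty
  show ?case by simp
next
  case (insert i I)
  have rv [measurable]: "random_variable borel (Z j)" if "j \<in> insert i I" for j
    using insert.prems(1) that unfolding indep_vars_def by blast
  have bound: "AE \<omega> in M. norm (Z j \<omega>) \<le> B" if "j \<in> insert i I" for j
    using insert.prems(3) that by (intro AE_I2) simp
  have int: "integrable M (Z j)" "integrable M (\<lambda>\<omega>. (Z j \<omega>)\<^sup>2)" if "j \<in> insert i I" for j
  proof -
    show "integrable M (Z j)"
      using bound[OF that] rv[OF that] by (rule integrable_const_bound)
    show "integrable M (\<lambda>\<omega>. (Z j \<omega>)\<^sup>2)"
    proof (rule integrable_const_bound[where B = "B\<^sup>2"], rule AE_I2)
      show "norm ((Z j \<omega>)\<^sup>2) \<le> B\<^sup>2" if "\<omega> \<in> space M" for \<omega>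
        using power_mono[OF insert.prems(3)[OF \<open>j \<in> insert i I\<close> that] abs_ge_zero, of 2] by simp
    qed (use rv[OF that] in simp)
  qed
  define S where "S \<omega> = (\<Sum>j\<in>I. Z j \<omega>)" for \<omega>
  have S [measurable]: "random_variable borel S"
    unfolding S_def using rv by (intro borel_measurable_sum) auto
  have S_bound: "\<bar>S \<omega>\<bar> \<le> real (card I) * B" if "\<omega> \<in> space M" for \<omega>
  proof -
    have "\<bar>S \<omega>\<bar> \<le> (\<Sum>j\<in>I. \<bar>Z j \<omega>\<bar>)"
      unfolding S_def by (rule sum_abs)
    also have "\<dots> \<le> (\<Sum>j\<in>I. B)"
      using insert.prems(3) that by (intro sum_mono) auto
    finally show ?thesis by simp
  qed
  have intS: "integrable M S"
    using S_bound by (intro integrable_const_bound[where B = "real (card I) * B"] AE_I2) auto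
  have intS2: "integrable M (\<lambda>\<omega>. (S \<omega>)\<^sup>2)"
  proof (rule integrable_const_bound[where B = "(real (card I) * B)\<^sup>2"], rule AE_I2)
    show "norm ((S \<omega>)\<^sup>2) \<le> (real (card I) * B)\<^sup>2" if "\<omega> \<in> space M" for \<omega>
      using power_mono[OF S_bound[OF that] abs_ge_zero, of 2] by simp
  qed simp
  have ind: "indep_var borel (Z i) borel S"
    unfolding S_def using insert by (intro indep_vars_sum) auto
  have "expectation (\<lambda>\<omega>. (\<Sum>j\<in>insert i I. Z j \<omega>)\<^sup>2)
      = expectation (\<lambda>\<omega>. (Z i \<omega>)\<^sup>2 + 2 * (Z i \<omega> * S \<omega>) + (S \<omega>)\<^sup>2)"
    using insert.hyps by (simp add: S_def power2_sum algebra_simps)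
  also have "\<dots> = expectation (\<lambda>\<omega>. (Z i \<omega>)\<^sup>2) + 2 * expectation (\<lambda>\<omega>. Z i \<omega> * S \<omega>) + expectation (\<lambda>\<omega>. (S \<omega>)\<^sup>2)"
    using int intS2 indep_var_integrable[OF ind _ intS] by simp
  also have "expectation (\<lambda>\<omega>. Z i \<omega> * S \<omega>) = 0"
    using indep_var_lebesgue_integral[OF ind _ intS] int insert.prems(2) by simp
  also have "expectation (\<lambda>\<omega>. (S \<omega>)\<^sup>2) = (\<Sum>j\<in>I. expectation (\<lambda>\<omega>. (Z j \<omega>)\<^sup>2))"
    unfolding S_def using insert.prems indep_vars_subset[OF insert.prems(1)]
    by (intro insert.IH) auto
  finally show ?case
    using insert.hyps by simp
qed

text \<open>
  The variance of each \<open>G i\<close> is at most its second moment, hence at most \<open>B * e\<close>.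
\<close>
lemma (in prob_space) second_moment_affine_average_le:
  fixes G :: "nat \<Rightarrow> 'a \<Rightarrow> real"
  assumes "0 < m" and indep: "indep_vars (\<lambda>_. borel) G {1..m}"
    and range: "\<And>i \<omega>. i \<in> {1..m} \<Longrightarrow> \<omega> \<in> space M \<Longrightarrow> 0 \<le> G i \<omega> \<and> G i \<omega> \<le> B"
    and mean: "\<And>i. i \<in> {1..m} \<Longrightarrow> expectation (G i) \<le> e"
    and "0 \<le> a" "0 \<le> b"
  defines "A \<equiv> \<lambda>\<omega>. a * ((1 / real m) * (\<Sum>i=1..m. G i \<omega>)) + b"
  shows "integrable M A" "integrable M (\<lambda>\<omega>. (A \<omega>)\<^sup>2)"
    and "expectation A \<le> a * e + b"
    and "expectation (\<lambda>\<omega>. (A \<omega>)\<^sup>2) \<le> a\<^sup>2 * B * e / real m + (a * e + b)\<^sup>2"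
proof -
  have rv [measurable]: "random_variable borel (G i)" if "i \<in> {1..m}" for i
    using indep that unfolding indep_vars_def by blast
  have intG: "integrable M (G i)" if "i \<in> {1..m}" for i
    using range[OF that] rv[OF that] by (intro integrable_const_bound[where B = B] AE_I2) auto
  have intG2: "integrable M (\<lambda>\<omega>. (G i \<omega>)\<^sup>2)" if "i \<in> {1..m}" for i
    using range[OF that] rv[OF that] by (intro integrable_const_bound[where B = "B\<^sup>2"] AE_I2) (auto intro: power_mono)
  have A_meas [measurable]: "random_variable borel A"
    unfolding A_def using rv by (intro borel_measurable_add borel_measurable_times borel_measurable_sum) auto
  show intA: "integrable M A"
    unfolding A_def using intG by (intro Bochner_Integration.integrable_add integrable_mult_right Bochner_Integration.integrable_sum) auto
  have A_range: "0 \<le> A \<omega> \<and> A \<omega> \<le> a * B + b" if "\<omega> \<in> space M" for \<omega>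
  proof
    show "0 \<le> A \<omega>"
      unfolding A_def using range that \<open>0 \<le> a\<close> \<open>0 \<le> b\<close>
      by (intro add_nonneg_nonneg mult_nonneg_nonneg sum_nonneg) auto
    have "(\<Sum>i=1..m. G i \<omega>) \<le> (\<Sum>i=1..m. B)"
      using range that by (intro sum_mono) auto
    then have "1 / real m * (\<Sum>i=1..m. G i \<omega>) \<le> B"
      using \<open>0 < m\<close> by (simp add: field_simps)
    then show "A \<omega> \<le> a * B + b"
      using \<open>0 \<le> a\<close> by (simp only: A_def add_le_cancel_right mult_left_mono)
  qed
  show intA2: "integrable M (\<lambda>\<omega>. (A \<omega>)\<^sup>2)"
    using A_range by (intro integrable_const_bound[where B = "(a * B + b)\<^sup>2"] AE_I2) (auto intro: power_mono)
  define \<mu> where "\<mu> i = expectation (G i)" for i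
  define Z where "Z i \<omega> = G i \<omega> - \<mu> i" for i \<omega>
  have \<mu>: "0 \<le> \<mu> i" if "i \<in> {1..m}" for i
    unfolding \<mu>_def using range[OF that] by (intro integral_nonneg_AE AE_I2) auto
  have "integrable M (\<lambda>\<omega>. \<Sum>i=1..m. G i \<omega>)"
    using intG by (rule Bochner_Integration.integrable_sum)
  moreover have "expectation (\<lambda>\<omega>. \<Sum>i=1..m. G i \<omega>) = (\<Sum>i=1..m. \<mu> i)"
    unfolding \<mu>_def using intG by (rule Bochner_Integration.integral_sum)
  ultimately have EA: "expectation A = a * ((1 / real m) * (\<Sum>i=1..m. \<mu> i)) + b"
    by (simp add: A_def prob_space)
  have "(\<Sum>i=1..m. \<mu> i) \<le> (\<Sum>i=1..m. e)"
    unfolding \<mu>_def using mean by (intro sum_mono) auto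
  then have "1 / real m * (\<Sum>i=1..m. \<mu> i) \<le> e"
    using \<open>0 < m\<close> by (simp add: field_simps)
  then show EA_le: "expectation A \<le> a * e + b"
    unfolding EA using \<open>0 \<le> a\<close> by (simp only: add_le_cancel_right mult_left_mono)
  have "0 \<le> expectation A"
    using A_range by (intro integral_nonneg_AE AE_I2) auto
  have var_le: "expectation (\<lambda>\<omega>. (Z i \<omega>)\<^sup>2) \<le> B * e" if i: "i \<in> {1..m}" for i
  proof -
    obtain \<omega> where \<omega>: "\<omega> \<in> space M" using not_empty by blast
    have "0 \<le> B" using range[OF i \<omega>] by linarith
    have "expectation (\<lambda>\<omega>. (Z i \<omega>)\<^sup>2) = expectation (\<lambda>\<omega>. (G i \<omega>)\<^sup>2) - (\<mu> i)\<^sup>2"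
      unfolding Z_def \<mu>_def using intG[OF i] intG2[OF i] by (rule variance_eq)
    also have "\<dots> \<le> expectation (\<lambda>\<omega>. (G i \<omega>)\<^sup>2)" by simp
    also have "\<dots> \<le> expectation (\<lambda>\<omega>. B * G i \<omega>)"
    proof (rule integral_mono[OF intG2[OF i]])
      show "integrable M (\<lambda>\<omega>. B * G i \<omega>)" using intG[OF i] by simp
      show "(G i \<omega>)\<^sup>2 \<le> B * G i \<omega>" if "\<omega> \<in> space M" for \<omega>
        unfolding power2_eq_square using range[OF i that] by (intro mult_right_mono) auto
    qed
    also have "\<dots> = B * \<mu> i" by (simp add: \<mu>_def)
    also have "\<dots> \<le> B * e"
      using mean[OF i] \<open>0 \<le> B\<close> by (intro mult_left_mono) (auto simp: \<mu>_def)
    finally show ?thesis .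
  qed
  have "expectation (\<lambda>\<omega>. (\<Sum>i=1..m. Z i \<omega>)\<^sup>2) = (\<Sum>i=1..m. expectation (\<lambda>\<omega>. (Z i \<omega>)\<^sup>2))"
  proof (rule expectation_power2_sum_indep_vars)
    show "indep_vars (\<lambda>_. borel) Z {1..m}"
      unfolding Z_def by (rule indep_vars_compose2[OF indep]) simp
    show "expectation (Z i) = 0" if "i \<in> {1..m}" for i
      unfolding Z_def using intG[OF that] by (simp add: \<mu>_def prob_space)
    \<comment> \<open>\<open>G i\<close> and its mean are both nonnegative, so their difference lies
      between \<open>- e\<close> and \<open>B\<close>.\<close>
    show "\<bar>Z i \<omega>\<bar> \<le> B + \<bar>e\<bar>" if "i \<in> {1..m}" "\<omega> \<in> space M" for i \<omega>
      using range[OF that] \<mu>[OF that(1)] mean[OF that(1)] unfolding Z_def \<mu>_def by linarith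
  qed simp
  also have "\<dots> \<le> (\<Sum>i=1..m. B * e)"
    using var_le by (intro sum_mono) auto
  finally have sum_le: "expectation (\<lambda>\<omega>. (\<Sum>i=1..m. Z i \<omega>)\<^sup>2) \<le> real m * (B * e)" by simp
  \<comment> \<open>The shift \<open>b\<close> drops out of the variance. Of the factor
    \<open>1 / m\<^sup>2\<close>, one \<open>1 / m\<close> is consumed by the \<open>m\<close>
    summands.\<close>
  have "variance A = expectation (\<lambda>\<omega>. (a / real m)\<^sup>2 * (\<Sum>i=1..m. Z i \<omega>)\<^sup>2)"
    unfolding EA power_mult_distrib[symmetric]
    by (simp add: A_def Z_def sum_subtractf algebra_simps diff_divide_distrib)
  also have "\<dots> = (a / real m)\<^sup>2 * expectation (\<lambda>\<omega>. (\<Sum>i=1..m. Z i \<omega>)\<^sup>2)"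
    by simp
  also have "\<dots> \<le> (a / real m)\<^sup>2 * (real m * (B * e))"
    using sum_le by (intro mult_left_mono) auto
  also have "\<dots> = a\<^sup>2 * B * e / real m"
    using \<open>0 < m\<close> by (simp add: power_divide power2_eq_square)
  finally have "variance A \<le> a\<^sup>2 * B * e / real m" .
  \<comment> \<open>The second moment is the variance plus the squared mean; squaring the bound on
    the mean uses that the mean is nonnegative.\<close>
  moreover have "(expectation A)\<^sup>2 \<le> (a * e + b)\<^sup>2"
    using EA_le \<open>0 \<le> expectation A\<close> by (intro power_mono)
  ultimately show "expectation (\<lambda>\<omega>. (A \<omega>)\<^sup>2) \<le> a\<^sup>2 * B * e / real m + (a * e + b)\<^sup>2"
    using variance_eq[OF intA intA2] by linarith
qed

section \<open>Grids, nets and their two error terms\<close>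

lemma interval_grid:
  fixes y D :: real
  assumes "0 \<le> y" "y \<le> D" "0 < k"
  shows "\<exists>j<k. \<bar>y - (real j + 1 / 2) * (D / real k)\<bar> \<le> D / (2 * real k)"
\<comment> \<open>The floor would put the right end \<open>y = D\<close> into cell \<open>k\<close>,
  one too far; it belongs to cell \<open>k - 1\<close>. This case also absorbs \<open>D = 0\<close>,
  so the other one may divide by \<open>D\<close>.\<close>
proof (cases "y = D")
  case True
  have "(real (k - 1) + 1 / 2) * (D / real k) = D - D / (2 * real k)"
    using \<open>0 < k\<close> by (simp add: of_nat_diff field_simps)
  then show ?thesis
    using True assms by (intro exI[of _ "k - 1"]) simp
next
  case False
  with assms have "0 < D" "y < D" by auto
  define j where "j = nat \<lfloor>y * real k / D\<rfloor>"
  have j: "real j \<le> y * real k / D" "y * real k / D < real j + 1"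
    using assms \<open>0 < D\<close> by (auto simp: j_def)
  have "y * real k / D < real k"
    using \<open>y < D\<close> \<open>0 < D\<close> \<open>0 < k\<close> by (simp add: field_simps)
  with j have "j < k" by linarith
  moreover have "\<bar>y - (real j + 1 / 2) * (D / real k)\<bar> \<le> D / (2 * real k)"
  proof -
    define w where "w = D / real k"
    have "0 < w" using \<open>0 < D\<close> \<open>0 < k\<close> by (simp add: w_def)
    have "y = y * real k / D * w" using \<open>0 < D\<close> \<open>0 < k\<close> by (simp add: w_def)
    then have "real j * w \<le> y" "y \<le> (real j + 1) * w"
      using j \<open>0 < w\<close> by (metis mult_right_mono less_imp_le)+
    then have "y - (real j + 1 / 2) * w \<le> w / 2" "- (w / 2) \<le> y - (real j + 1 / 2) * w"
      by (simp_all add: algebra_simps)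
    then have "\<bar>y - (real j + 1 / 2) * w\<bar> \<le> w / 2"
      by (simp only: abs_le_iff) simp
    then show ?thesis by (simp add: w_def)
  qed
  ultimately show ?thesis by blast
qed

lemma norm_le_sqrt_card_mult:
  fixes x :: "real ^ 'p"
  assumes "\<And>i. \<bar>x $ i\<bar> \<le> h"
  shows "norm x \<le> sqrt (real CARD('p)) * h"
proof -
  have "0 \<le> h" using assms[of undefined] by linarith
  have "(x $ i)\<^sup>2 \<le> h\<^sup>2" for i
    using power_mono[OF assms abs_ge_zero, of i 2] by simp
  then have "(\<Sum>i\<in>UNIV. (x $ i)\<^sup>2) \<le> (\<Sum>i\<in>(UNIV :: 'p set). h\<^sup>2)"
    by (intro sum_mono) auto
  then have "norm x \<le> sqrt (real CARD('p) * h\<^sup>2)"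
    by (simp add: norm_vec_def L2_set_def)
  then show ?thesis
    using \<open>0 \<le> h\<close> by (simp add: real_sqrt_mult)
qed

text \<open>
  The net consists of the cell centers of a grid, projected onto \<open>X\<close>. The projection is
  nonexpansive and fixes \<open>X\<close>, so the radius is half the diameter of a cell.
\<close>
lemma finite_net_in_cube:
  fixes X :: "(real ^ 'p) set"
  assumes cube: "contained_in_cube X D" and X: "X \<noteq> {}" "convex X" "closed X" and "0 < k"
  obtains V where "finite V" "V \<noteq> {}" "V \<subseteq> X" "card V \<le> k ^ CARD('p)"
    and "\<And>x. x \<in> X \<Longrightarrow> \<exists>v\<in>V. norm (x - v) \<le> sqrt (real CARD('p)) * (D / (2 * real k))"
proof -
  obtain T :: "real ^ 'p \<Rightarrow> real ^ 'p" and a where T: "orthogonal_transformation T"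
    and XT: "X \<subseteq> T ` {x. \<forall>i. a $ i \<le> x $ i \<and> x $ i \<le> a $ i + D}"
    using cube unfolding contained_in_cube_def by blast
  \<comment> \<open>Centers in the unrotated cube, with one cell index per coordinate. The isometry
    \<open>T\<close> carries them to the rotated cube without changing distances.\<close>
  define c :: "('p \<Rightarrow> nat) \<Rightarrow> real ^ 'p"
    where "c g = (\<chi> i. a $ i + (real (g i) + 1 / 2) * (D / real k))" for g
  define I where "I = (UNIV :: 'p set) \<rightarrow>\<^sub>E {..<k}"
  define V where "V = (\<lambda>g. closest_point X (T (c g))) ` I"
  have "finite I" by (simp add: I_def finite_PiE)
  have "card I = k ^ CARD('p)" by (simp add: I_def card_PiE)
  show ?thesis
  proof
    show "finite V" unfolding V_def using \<open>finite I\<close> by simp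
    show "card V \<le> k ^ CARD('p)"
      unfolding V_def \<open>card I = k ^ CARD('p)\<close>[symmetric] using \<open>finite I\<close> by (rule card_image_le)
    show "V \<subseteq> X"
      unfolding V_def using X by (auto intro: closest_point_in_set)
    show "V \<noteq> {}"
      using \<open>card I = k ^ CARD('p)\<close> \<open>0 < k\<close> unfolding V_def by auto
  next
    fix x assume "x \<in> X"
    with XT obtain y where y: "x = T y" "\<And>i. a $ i \<le> y $ i" "\<And>i. y $ i \<le> a $ i + D" by blast
    have "\<forall>i. \<exists>j<k. \<bar>(y $ i - a $ i) - (real j + 1 / 2) * (D / real k)\<bar> \<le> D / (2 * real k)"
      using y \<open>0 < k\<close> by (intro allI interval_grid) (auto simp: algebra_simps)
    then obtain g where g: "\<And>i. g i < k"
      "\<And>i. \<bar>(y $ i - a $ i) - (real (g i) + 1 / 2) * (D / real k)\<bar> \<le> D / (2 * real k)"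
      by metis
    have "norm (y - c g) \<le> sqrt (real CARD('p)) * (D / (2 * real k))"
      using g(2) by (intro norm_le_sqrt_card_mult) (simp add: c_def algebra_simps)
    moreover have "norm (x - T (c g)) = norm (y - c g)"
      unfolding y(1) using T
      by (metis linear_diff orthogonal_transformation_linear orthogonal_transformation_norm)
    moreover have "norm (x - closest_point X (T (c g))) \<le> norm (x - T (c g))"
      using closest_point_lipschitz[OF X(2,3,1), of x "T (c g)"] closest_point_self[OF \<open>x \<in> X\<close>]
      by (simp add: dist_norm)
    moreover have "closest_point X (T (c g)) \<in> V"
      unfolding V_def using g(1) by (intro imageI) (simp add: I_def PiE_iff)
    ultimately show "\<exists>v\<in>V. norm (x - v) \<le> sqrt (real CARD('p)) * (D / (2 * real k))"
      by (intro bexI[of _ "closest_point X (T (c g))"]) linarith+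
  qed
qed

text \<open>This is \<open>ln u \<le> u - 1\<close> at \<open>u = x powr a / exp 1\<close>, with
  equality when \<open>x powr a = exp 1\<close>. It is the source of \<open>exp 1\<close> in
  \<open>N_F\<close>.\<close>

lemma ln_le_powr_div:
  fixes x a :: real
  assumes "0 < x" "0 < a"
  shows "ln x \<le> x powr a / (a * exp 1)"
proof -
  have "a * ln x = ln (x powr a)" using assms by (simp add: ln_powr)
  also have "\<dots> = ln (x powr a / exp 1) + 1" using assms by (simp add: ln_div)
  also have "\<dots> \<le> x powr a / exp 1"
    using ln_le_minus_one[of "x powr a / exp 1"] assms by simp
  finally show ?thesis using assms by (simp add: field_simps)
qed

text \<open>A grid with \<open>\<lfloor>n powr (1 / (2 * \<gamma>))\<rfloor>\<close> cells per coordinate balances the two error terms.\<close>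
lemma holder_grid_error:
  fixes D L \<gamma> l :: real and n p :: nat
  assumes "0 < n" "0 < \<gamma>" "l < 1 / 2" "0 \<le> L" "0 \<le> D"
  defines "k \<equiv> nat \<lfloor>real n powr (1 / (2 * \<gamma>))\<rfloor>"
  shows "0 < k"
    and "L * (sqrt (real p) * (D / (2 * real k))) powr \<gamma>
      \<le> L * D powr \<gamma> * real p powr (\<gamma> / 2) / real n powr l"
proof -
  define \<kappa> where "\<kappa> = real n powr (1 / (2 * \<gamma>))"
  have "1 \<le> \<kappa>" unfolding \<kappa>_def using assms by (intro ge_one_powr_ge_zero) auto
  then have "1 \<le> \<lfloor>\<kappa>\<rfloor>" by simp
  then have "0 < k" "real k = of_int \<lfloor>\<kappa>\<rfloor>" and "1 \<le> real_of_int \<lfloor>\<kappa>\<rfloor>"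
    unfolding k_def \<kappa>_def[symmetric] by simp_all
  \<comment> \<open>Rounding down costs at most a factor 2, since
    \<open>\<kappa> < real k + 1 \<le> 2 * real k\<close>. The 2 in the half-width
    \<open>D / (2 * real k)\<close> pays for it.\<close>
  then have k: "0 < k" "\<kappa> \<le> 2 * real k"
    using real_of_int_floor_add_one_gt[of \<kappa>] by linarith+
  show "0 < k" by (fact k(1))
  have "D / (2 * real k) \<le> D / \<kappa>"
    using k \<open>1 \<le> \<kappa>\<close> \<open>0 \<le> D\<close> by (intro divide_left_mono) auto
  then have "sqrt (real p) * (D / (2 * real k)) \<le> sqrt (real p) * (D / \<kappa>)"
    by (intro mult_left_mono) auto
  then have "(sqrt (real p) * (D / (2 * real k))) powr \<gamma> \<le> (sqrt (real p) * (D / \<kappa>)) powr \<gamma>"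
    using assms k by (intro powr_mono2) auto
  also have "\<dots> = real p powr (\<gamma> / 2) * (D powr \<gamma> / \<kappa> powr \<gamma>)"
    using assms \<open>1 \<le> \<kappa>\<close> by (simp add: powr_mult powr_divide powr_powr powr_half_sqrt[symmetric])
  also have "\<kappa> powr \<gamma> = real n powr (1 / 2)"
    using assms by (simp add: \<kappa>_def powr_powr)
  also have "real p powr (\<gamma> / 2) * (D powr \<gamma> / real n powr (1 / 2))
      \<le> real p powr (\<gamma> / 2) * (D powr \<gamma> / real n powr l)"
    using assms by (intro mult_left_mono divide_left_mono powr_mono mult_pos_pos) auto
  finally have "L * (sqrt (real p) * (D / (2 * real k))) powr \<gamma>
      \<le> L * (real p powr (\<gamma> / 2) * (D powr \<gamma> / real n powr l))"
    using \<open>0 \<le> L\<close> by (rule mult_left_mono)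
  then show "L * (sqrt (real p) * (D / (2 * real k))) powr \<gamma>
      \<le> L * D powr \<gamma> * real p powr (\<gamma> / 2) / real n powr l"
    by (simp add: mult_ac)
qed

text \<open>The logarithm of the size of the net is at most
  \<open>p * ln n / (2 * \<gamma>)\<close>. Trading \<open>ln n\<close> for
  \<open>n powr (1 - 2 * l)\<close> is tuned so that the square root, divided by
  \<open>sqrt n\<close>, is exactly \<open>1 / n powr l\<close>. Splitting the square root of the
  sum produces the last two summands of \<open>N_F\<close>.\<close>

lemma massart_grid_error:
  fixes B \<gamma> l :: real and n p c :: nat
  assumes "0 < n" "0 < \<gamma>" "l < 1 / 2" "0 \<le> B" "0 < c"
    and c_le: "c \<le> nat \<lfloor>real n powr (1 / (2 * \<gamma>))\<rfloor> ^ p"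
  shows "B / sqrt n * sqrt (2 * ln (2 * real c))
    \<le> (B * sqrt (2 * ln 2) + B * sqrt (real p) / sqrt (\<gamma> * (1 - 2 * l) * exp 1)) / real n powr l"
proof -
  define \<kappa> where "\<kappa> = real n powr (1 / (2 * \<gamma>))"
  define q where "q = real p / (\<gamma> * (1 - 2 * l) * exp 1)"
  have "1 \<le> \<kappa>" unfolding \<kappa>_def using assms by (intro ge_one_powr_ge_zero) auto
  have "real c \<le> real (nat \<lfloor>\<kappa>\<rfloor>) ^ p"
    using c_le unfolding \<kappa>_def by (metis of_nat_le_iff of_nat_power)
  also have "\<dots> \<le> \<kappa> ^ p"
    using \<open>1 \<le> \<kappa>\<close> by (intro power_mono) auto
  finally have "ln (real c) \<le> ln (\<kappa> ^ p)"
    using \<open>0 < c\<close> \<open>1 \<le> \<kappa>\<close> by (subst ln_le_cancel_iff) auto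
  also have "\<dots> = real p * ln (real n) / (2 * \<gamma>)"
    using assms by (simp add: \<kappa>_def ln_realpow ln_powr)
  finally have ln_c: "2 * ln (real c) \<le> real p * ln (real n) / \<gamma>"
    using \<open>0 < \<gamma>\<close> by (simp add: field_simps)
  also have "\<dots> \<le> real p * (real n powr (1 - 2 * l) / ((1 - 2 * l) * exp 1)) / \<gamma>"
    using assms by (intro divide_right_mono mult_left_mono ln_le_powr_div) auto
  also have "\<dots> = q * real n powr (1 - 2 * l)"
    by (simp add: q_def mult_ac)
  finally have "2 * ln (2 * real c) \<le> 2 * ln 2 + q * real n powr (1 - 2 * l)"
    using \<open>0 < c\<close> by (simp add: ln_mult)
  then have "sqrt (2 * ln (2 * real c)) \<le> sqrt (2 * ln 2 + q * real n powr (1 - 2 * l))"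
    by (rule real_sqrt_le_mono)
  also have "\<dots> \<le> sqrt (2 * ln 2) + sqrt (q * real n powr (1 - 2 * l))"
    using assms by (intro sqrt_add_le_add_sqrt) (auto simp: q_def)
  finally have "B / sqrt n * sqrt (2 * ln (2 * real c))
      \<le> B / sqrt n * (sqrt (2 * ln 2) + sqrt (q * real n powr (1 - 2 * l)))"
    using assms by (intro mult_left_mono) auto
  also have "\<dots> = B * (1 / sqrt n * sqrt (2 * ln 2)) + B * (sqrt (q * real n powr (1 - 2 * l)) / sqrt n)"
    by (simp add: algebra_simps)
  also have "sqrt (q * real n powr (1 - 2 * l)) / sqrt n = sqrt q * (sqrt (real n powr (1 - 2 * l)) / sqrt n)"
    by (simp add: real_sqrt_mult)
  also have "sqrt (real n powr (1 - 2 * l)) = real n powr (1 / 2 - l)"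
    using assms by (simp add: powr_half_sqrt[symmetric] powr_powr algebra_simps)
  also have "sqrt n = real n powr (1 / 2)"
    using assms by (simp add: powr_half_sqrt)
  also have "real n powr (1 / 2 - l) / real n powr (1 / 2) = 1 / real n powr l"
    using assms by (simp add: powr_diff)
  also have "1 / real n powr (1 / 2) \<le> 1 / real n powr l"
    using assms by (intro divide_left_mono powr_mono mult_pos_pos) auto
  finally have "B / real n powr (1 / 2) * sqrt (2 * ln (2 * real c))
      \<le> B * (1 / real n powr l * sqrt (2 * ln 2)) + B * (sqrt q * (1 / real n powr l))"
    using assms by (simp add: mult_left_mono mult_right_mono)
  then show ?thesis
    using assms by (simp add: powr_half_sqrt q_def real_sqrt_divide add_divide_distrib mult_ac)
qed

section \<open>Sample averages and the true objective\<close>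

text \<open>Writing a replication as a block of consecutive indices of the whole sample makes the
  independence of disjoint blocks applicable.\<close>

lemma saa_obj_replication:
  assumes "i \<in> {1..m}"
  shows "saa_obj F n (replication n s i) x = (1 / real n) * (\<Sum>k=(i - 1) * n + 1..i * n. F x (s k))"
proof -
  \<comment> \<open>Replications are numbered from 1, so the truncated subtraction
    \<open>i - 1\<close> is exact.\<close>
  have "i * n = n + (i - 1) * n"
    using assms by (cases i) auto
  then have "(\<Sum>k=(i - 1) * n + 1..i * n. F x (s k)) = (\<Sum>k=1 + (i - 1) * n..n + (i - 1) * n. F x (s k))"
    by (simp add: add.commute)
  also have "\<dots> = (\<Sum>j=1..n. F x (s (j + (i - 1) * n)))"
    by (rule sum.shift_bounds_cl_nat_ivl)
  finally show ?thesis
    by (simp add: saa_obj_def replication_def add.commute)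
qed

lemma iid_copies_expectation:
  fixes F :: "real ^ 'p \<Rightarrow> real ^ 'd \<Rightarrow> real"
  assumes "prob_space M" "\<xi> \<in> M \<rightarrow>\<^sub>M restrict_space borel \<Xi>" "iid_copies M \<Xi> \<xi> N S" "k \<in> {1..N}"
    and "F x \<in> borel_measurable (restrict_space borel \<Xi>)"
  shows "prob_space.expectation M (\<lambda>\<omega>. F x (S k \<omega>)) = true_obj M \<xi> F x"
proof -
  interpret prob_space M by fact
  have S: "S k \<in> M \<rightarrow>\<^sub>M restrict_space borel \<Xi>"
    using assms(3,4) by (auto simp: iid_copies_def indep_vars_def)
  have "distr M (restrict_space borel \<Xi>) (S k) = distr M (restrict_space borel \<Xi>) \<xi>"
    using assms(3,4) by (auto simp: iid_copies_def)
  then show ?thesis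
    unfolding true_obj_def
    using integral_distr[OF S assms(5)] integral_distr[OF assms(2,5)] by simp
qed

text \<open>Each \<open>G i\<close> is a function of its own block of the sample, and the blocks are
  disjoint; the maximum over a finite \<open>V\<close> is measurable at once. The range
  \<open>2 * B\<close> adds the bounds on the sample average and on the true objective.\<close>

lemma saa_Max_deviation:
  fixes F :: "real ^ 'p \<Rightarrow> real ^ 'd \<Rightarrow> real"
  assumes "prob_space M" and \<xi>: "\<xi> \<in> M \<rightarrow>\<^sub>M restrict_space borel \<Xi>"
    and iid: "iid_copies M \<Xi> \<xi> (m * n) S" and "0 < n" "0 < B"
    and V: "finite V" "V \<noteq> {}"
    and meas: "\<And>v. v \<in> V \<Longrightarrow> F v \<in> borel_measurable (restrict_space borel \<Xi>)"
    and bound: "\<And>v z. v \<in> V \<Longrightarrow> z \<in> \<Xi> \<Longrightarrow> \<bar>F v z\<bar> \<le> B"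
  defines "G \<equiv> \<lambda>i \<omega>. MAX v\<in>V. \<bar>saa_obj F n (replication n (\<lambda>k. S k \<omega>) i) v - true_obj M \<xi> F v\<bar>"
  shows "prob_space.indep_vars M (\<lambda>_. borel) G {1..m}"
    and "\<And>i \<omega>. i \<in> {1..m} \<Longrightarrow> \<omega> \<in> space M \<Longrightarrow> 0 \<le> G i \<omega> \<and> G i \<omega> \<le> 2 * B"
    and "\<And>i. i \<in> {1..m} \<Longrightarrow> prob_space.expectation M (G i) \<le> B / sqrt n * sqrt (2 * ln (2 * real (card V)))"
proof -
  interpret prob_space M by fact
  let ?dev = "\<lambda>J s v. \<bar>1 / real (card J) * (\<Sum>k\<in>J. F v (s k)) - true_obj M \<xi> F v\<bar>"
  define R where "R = (restrict_space borel \<Xi> :: (real ^ 'd) measure)"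
  define J where "J i = {(i - 1) * n + 1..i * n}" for i
  have J_sub: "J i \<subseteq> {1..m * n}" if "i \<in> {1..m}" for i
    using that by (auto simp: J_def intro: order_trans[OF _ mult_le_mono1])
  have J_card: "card (J i) = n" if "i \<in> {1..m}" for i
    using that by (cases i) (auto simp: J_def)
  have "J i \<inter> J i' = {}" if "i < i'" for i i'
  proof -
    have "i * n \<le> (i' - 1) * n" using that by (intro mult_le_mono1) simp
    show ?thesis
    proof (rule Int_emptyI)
      fix k assume "k \<in> J i" "k \<in> J i'"
      then have "k \<le> i * n" "(i' - 1) * n + 1 \<le> k"
        unfolding J_def by (simp_all only: atLeastAtMost_iff)
      with \<open>i * n \<le> (i' - 1) * n\<close> show False by linarith
    qed
  qed
  then have J_disj: "disjoint_family_on J {1..m}"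
    unfolding disjoint_family_on_def by (metis inf_commute linorder_neqE_nat)
  have indS: "indep_vars (\<lambda>_. R) S {1..m * n}"
    using iid by (simp add: iid_copies_def R_def)
  have S_rv: "S k \<in> M \<rightarrow>\<^sub>M R" if "k \<in> {1..m * n}" for k
    using indS that by (auto simp: indep_vars_def)
  have S_in: "S k \<omega> \<in> \<Xi>" if "k \<in> {1..m * n}" "\<omega> \<in> space M" for k \<omega>
    using measurable_space[OF S_rv[OF that(1)] that(2)] by (simp add: R_def space_restrict_space)
  have meas': "F v \<in> borel_measurable R" if "v \<in> V" for v
    using meas[OF that] by (simp add: R_def)
  have G_eq: "G i \<omega> = (MAX v\<in>V. ?dev (J i) (\<lambda>k. S k \<omega>) v)"
    if "i \<in> {1..m}" for i \<omega>
    unfolding G_def saa_obj_replication[OF that] J_card[OF that] by (simp only: J_def)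
  have true_le: "\<bar>true_obj M \<xi> F v\<bar> \<le> B" if "v \<in> V" for v
  proof -
    have "\<bar>true_obj M \<xi> F v\<bar> \<le> expectation (\<lambda>\<omega>. \<bar>F v (\<xi> \<omega>)\<bar>)"
      unfolding true_obj_def by (rule integral_abs_bound)
    also have "\<dots> \<le> expectation (\<lambda>_. B)"
      using bound[OF that] measurable_space[OF \<xi>]
      by (intro integral_mono') (auto simp: space_restrict_space \<open>0 < B\<close> less_imp_le)
    finally show ?thesis by (simp add: prob_space)
  qed
  have G_meas: "(\<lambda>s. MAX v\<in>V. ?dev (J i) s v)
      \<in> borel_measurable (Pi\<^sub>M (J i) (\<lambda>_. R))" for i
  proof (rule borel_measurable_Max[OF V(1)])
    fix v assume v: "v \<in> V"
    have "(\<lambda>s. F v (s k)) \<in> borel_measurable (Pi\<^sub>M (J i) (\<lambda>_. R))" if "k \<in> J i" for k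
    proof -
      have "(\<lambda>s. s k) \<in> Pi\<^sub>M (J i) (\<lambda>_. R) \<rightarrow>\<^sub>M R"
        using that by (rule measurable_component_singleton)
      then show ?thesis by (rule measurable_compose[OF _ meas'[OF v]])
    qed
    then show "(\<lambda>s. ?dev (J i) s v)
        \<in> borel_measurable (Pi\<^sub>M (J i) (\<lambda>_. R))"
      by (intro borel_measurable_abs borel_measurable_diff borel_measurable_times borel_measurable_sum) auto
  qed
  \<comment> \<open>Composing with the restriction to \<open>J i\<close> displays \<open>G i\<close>
    as a measurable function of a random element of the product space over its block.\<close>
  have "indep_vars (\<lambda>_. borel) (\<lambda>i \<omega>. (\<lambda>s. MAX v\<in>V. ?dev (J i) s v)
      (restrict (\<lambda>k. S k \<omega>) (J i))) {1..m}"
    by (rule indep_vars_compose2[OF indep_vars_restrict[OF indS J_sub J_disj] G_meas])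
  also have "?this \<longleftrightarrow> indep_vars (\<lambda>_. borel) G {1..m}"
    by (intro indep_vars_cong) (auto simp: G_eq fun_eq_iff)
  finally show "indep_vars (\<lambda>_. borel) G {1..m}" .

  fix i assume i: "i \<in> {1..m}"
  show "0 \<le> G i \<omega> \<and> G i \<omega> \<le> 2 * B" if \<omega>: "\<omega> \<in> space M" for \<omega>
  proof -
    have dev_le: "?dev (J i) (\<lambda>k. S k \<omega>) v \<le> 2 * B" if v: "v \<in> V" for v
    proof -
      have "\<bar>\<Sum>k\<in>J i. F v (S k \<omega>)\<bar> \<le> (\<Sum>k\<in>J i. \<bar>F v (S k \<omega>)\<bar>)"
        by (rule sum_abs)
      also have "\<dots> \<le> (\<Sum>k\<in>J i. B)"
        using bound[OF v] S_in[OF _ \<omega>] J_sub[OF i] by (intro sum_mono) auto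
      finally have "\<bar>1 / real (card (J i)) * (\<Sum>k\<in>J i. F v (S k \<omega>))\<bar> \<le> B"
        using \<open>0 < n\<close> by (simp add: abs_mult J_card[OF i] field_simps)
      with true_le[OF v] show ?thesis by linarith
    qed
    obtain v where v: "v \<in> V" using V by blast
    have "0 \<le> ?dev (J i) (\<lambda>k. S k \<omega>) v" by simp
    also have "\<dots> \<le> G i \<omega>"
      unfolding G_eq[OF i] using V v by (intro Max_ge) auto
    finally show ?thesis
      unfolding G_eq[OF i] using V dev_le by (subst Max_le_iff) auto
  qed
  have "expectation (\<lambda>\<omega>. MAX v\<in>V. ?dev (J i) (\<lambda>k. S k \<omega>) v)
      \<le> B / sqrt (card (J i)) * sqrt (2 * ln (2 * real (card V)))"
  proof (rule expectation_Max_deviation_le[OF V _ _ \<open>0 < B\<close>])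
    show "finite (J i)" by (simp add: J_def)
    show "J i \<noteq> {}" using J_card[OF i] \<open>0 < n\<close> by auto
    fix v assume v: "v \<in> V"
    show "indep_vars (\<lambda>_. borel) (\<lambda>k \<omega>. F v (S k \<omega>)) (J i)"
      by (rule indep_vars_compose2[OF indep_vars_subset[OF indS J_sub[OF i]] meas'[OF v]])
    fix k assume "k \<in> J i"
    then have k: "k \<in> {1..m * n}" using J_sub[OF i] by blast
    show "\<bar>F v (S k \<omega>)\<bar> \<le> B" if "\<omega> \<in> space M" for \<omega>
      using bound[OF v S_in[OF k that]] .
    show "expectation (\<lambda>\<omega>. F v (S k \<omega>)) = true_obj M \<xi> F v"
      by (rule iid_copies_expectation[where F = F and x = v, OF \<open>prob_space M\<close> \<xi> iid k meas[OF v]])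
  qed
  then show "expectation (G i) \<le> B / sqrt n * sqrt (2 * ln (2 * real (card V)))"
    by (simp add: G_eq[OF i] J_card[OF i] cong: Bochner_Integration.integral_cong)
qed

lemma true_obj_integrable:
  fixes F :: "real ^ 'p \<Rightarrow> real ^ 'd \<Rightarrow> real"
  assumes "prob_space M" and \<xi>: "\<xi> \<in> M \<rightarrow>\<^sub>M restrict_space borel \<Xi>"
    and "F x \<in> borel_measurable (restrict_space borel \<Xi>)"
    and bound: "\<And>z. z \<in> \<Xi> \<Longrightarrow> \<bar>F x z\<bar> \<le> B"
  shows "integrable M (\<lambda>\<omega>. F x (\<xi> \<omega>))"
proof -
  interpret prob_space M by fact
  show ?thesis
  proof (rule integrable_const_bound)
    show "AE \<omega> in M. norm (F x (\<xi> \<omega>)) \<le> B"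
      using bound measurable_space[OF \<xi>] by (intro AE_I2) (simp add: space_restrict_space)
    show "random_variable borel (\<lambda>\<omega>. F x (\<xi> \<omega>))"
      by (rule measurable_compose[OF \<xi> assms(3)])
  qed
qed

lemma true_obj_close:
  fixes F :: "real ^ 'p \<Rightarrow> real ^ 'd \<Rightarrow> real"
  assumes "prob_space M" and \<xi>: "\<xi> \<in> M \<rightarrow>\<^sub>M restrict_space borel \<Xi>"
    and int: "integrable M (\<lambda>\<omega>. F x (\<xi> \<omega>))" "integrable M (\<lambda>\<omega>. F y (\<xi> \<omega>))"
    and close: "\<And>z. z \<in> \<Xi> \<Longrightarrow> \<bar>F x z - F y z\<bar> \<le> c"
  shows "\<bar>true_obj M \<xi> F x - true_obj M \<xi> F y\<bar> \<le> c"
proof -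
  interpret prob_space M by fact
  have "true_obj M \<xi> F x - true_obj M \<xi> F y = expectation (\<lambda>\<omega>. F x (\<xi> \<omega>) - F y (\<xi> \<omega>))"
    unfolding true_obj_def using int by simp
  also have "\<bar>\<dots>\<bar> \<le> expectation (\<lambda>\<omega>. \<bar>F x (\<xi> \<omega>) - F y (\<xi> \<omega>)\<bar>)"
    by (rule integral_abs_bound)
  also have "\<dots> \<le> expectation (\<lambda>_. c)"
    using close measurable_space[OF \<xi>] int by (intro integral_mono) (auto simp: space_restrict_space)
  finally show ?thesis by (simp add: prob_space)
qed

lemma convex_on_true_obj:
  fixes X :: "(real ^ 'p) set"
  assumes "prob_space M" and \<xi>: "\<xi> \<in> M \<rightarrow>\<^sub>M restrict_space borel \<Xi>" and "convex X"
    and int: "\<And>x. x \<in> X \<Longrightarrow> integrable M (\<lambda>\<omega>. F x (\<xi> \<omega>))"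
    and conv: "\<And>z. z \<in> \<Xi> \<Longrightarrow> convex_on X (\<lambda>x. F x z)"
  shows "convex_on X (true_obj M \<xi> F)"
proof (rule convex_onI)
  interpret prob_space M by fact
  fix t :: real and x y assume t: "0 < t" "t < 1" and xy: "x \<in> X" "y \<in> X"
  let ?w = "(1 - t) *\<^sub>R x + t *\<^sub>R y"
  have "?w \<in> X" using \<open>convex X\<close> t xy by (intro convexD) auto
  have "true_obj M \<xi> F ?w \<le> expectation (\<lambda>\<omega>. (1 - t) * F x (\<xi> \<omega>) + t * F y (\<xi> \<omega>))"
    unfolding true_obj_def
  proof (rule integral_mono)
    show "integrable M (\<lambda>\<omega>. F ?w (\<xi> \<omega>))" using int \<open>?w \<in> X\<close> .
    show "integrable M (\<lambda>\<omega>. (1 - t) * F x (\<xi> \<omega>) + t * F y (\<xi> \<omega>))" using int xy by simp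
    show "F ?w (\<xi> \<omega>) \<le> (1 - t) * F x (\<xi> \<omega>) + t * F y (\<xi> \<omega>)" if "\<omega> \<in> space M" for \<omega>
      using measurable_space[OF \<xi> that] t xy
      by (intro convex_onD[OF conv]) (auto simp: space_restrict_space)
  qed
  also have "\<dots> = (1 - t) * true_obj M \<xi> F x + t * true_obj M \<xi> F y"
    unfolding true_obj_def using int xy by simp
  finally show "true_obj M \<xi> F ?w \<le> (1 - t) * true_obj M \<xi> F x + t * true_obj M \<xi> F y" .
qed fact

section \<open>Moments of the distance and the rates\<close>

text \<open>Everything follows from \<open>0 \<le> \<Delta> \<le> A\<close> pointwise, where
  \<open>A\<close> is affine in the average of the \<open>G i\<close>. The discretization error sits
  in the constant term of \<open>A\<close>, so it raises the mean but not the variance of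
  \<open>A\<close>. The mean is located in an interval because the rates also need its lower
  end.\<close>

lemma compromise_dist_moments:
  fixes X :: "(real ^ 'p) set" and F :: "real ^ 'p \<Rightarrow> real ^ 'd \<Rightarrow> real"
  assumes "prob_space M" and \<xi>: "\<xi> \<in> M \<rightarrow>\<^sub>M restrict_space borel \<Xi>"
    and X: "X \<noteq> {}" "compact X" "convex X" and cube: "contained_in_cube X D"
    and meas: "\<And>x. x \<in> X \<Longrightarrow> F x \<in> borel_measurable (restrict_space borel \<Xi>)"
    and "0 < \<gamma>"
    and holder: "\<And>x y z. x \<in> X \<Longrightarrow> y \<in> X \<Longrightarrow> z \<in> \<Xi> \<Longrightarrow> \<bar>F x z - F y z\<bar> \<le> L * norm (x - y) powr \<gamma>"
    and "0 < B" and bound: "\<And>x z. x \<in> X \<Longrightarrow> z \<in> \<Xi> \<Longrightarrow> \<bar>F x z\<bar> \<le> B"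
    and conv: "\<And>z. z \<in> \<Xi> \<Longrightarrow> convex_on X (\<lambda>x. F x z)"
    and "l < 1 / 2" "0 < \<epsilon>" "0 < m" "0 < n" "0 < \<rho>"
    and iid: "iid_copies M \<Xi> \<xi> (m * n) S"
    and sel: "\<And>i. i \<in> {1..m} \<Longrightarrow> eps_selection X \<Xi> F n \<epsilon> (sel i)"
    and dist_meas: "compromise_dist M X \<xi> F m n \<rho> \<epsilon> sel S \<in> borel_measurable M"
  defines "\<Delta> \<equiv> compromise_dist M X \<xi> F m n \<rho> \<epsilon> sel S"
    and "N \<equiv> N_F L \<gamma> D CARD('p) B l"
  shows "prob_space.expectation M \<Delta> \<in> {0..8 * diameter X * N / (\<epsilon> * real n powr l) + 2 * sqrt (\<epsilon> / \<rho>)}"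
    and "prob_space.variance M \<Delta>
      \<le> 64 * (diameter X)\<^sup>2 * B * N / (real m * \<epsilon>\<^sup>2 * real n powr l)
        + (8 * diameter X * N / (\<epsilon> * real n powr l) + 2 * sqrt (\<epsilon> / \<rho>))\<^sup>2"
proof -
  interpret prob_space M by fact
  define f where "f = true_obj M \<xi> F"
  define k where "k = nat \<lfloor>real n powr (1 / (2 * \<gamma>))\<rfloor>"
  have "0 \<le> D"
  proof -
    obtain T :: "real ^ 'p \<Rightarrow> real ^ 'p" and a
      where "X \<subseteq> T ` {x. \<forall>i. a $ i \<le> x $ i \<and> x $ i \<le> a $ i + D}"
      using cube unfolding contained_in_cube_def by blast
    then obtain y where "\<And>i. a $ i \<le> y $ i" "\<And>i. y $ i \<le> a $ i + D"
      using X(1) by blast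
    from order_trans[OF this, of undefined] show ?thesis by simp
  qed
  \<comment> \<open>The sign of \<open>L\<close> is still open. \<open>order_refl\<close>
    instantiates the Hoelder constant of \<open>holder_grid_error\<close> to 0, and \<open>k\<close>
    does not depend on it.\<close>
  have "0 < k"
    unfolding k_def
    by (rule holder_grid_error(1)[OF \<open>0 < n\<close> \<open>0 < \<gamma>\<close> \<open>l < 1 / 2\<close> order_refl \<open>0 \<le> D\<close>])
  obtain V where V: "finite V" "V \<noteq> {}" "V \<subseteq> X" "card V \<le> k ^ CARD('p)"
    and net: "\<And>x. x \<in> X \<Longrightarrow> \<exists>v\<in>V. norm (x - v) \<le> sqrt (real CARD('p)) * (D / (2 * real k))"
    using finite_net_in_cube[OF cube X(1,3) compact_imp_closed[OF X(2)] \<open>0 < k\<close>] by blast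
  \<comment> \<open>The absolute value keeps \<open>c\<close> nonnegative before the sign of
    \<open>L\<close> is settled.\<close>
  define c where "c = \<bar>L\<bar> * (sqrt (real CARD('p)) * (D / (2 * real k))) powr \<gamma>"
  define e where "e = B / sqrt n * sqrt (2 * ln (2 * real (card V)))"
  define a where "a = 4 * diameter X / \<epsilon>"
  define b where "b = 2 * sqrt (\<epsilon> / \<rho>)"
  define G where "G i \<omega> = (MAX v\<in>V. \<bar>saa_obj F n (replication n (\<lambda>k. S k \<omega>) i) v - f v\<bar>)" for i \<omega>
  define A where "A \<omega> = a * ((1 / real m) * (\<Sum>i=1..m. G i \<omega>)) + (a * (2 * c) + b)" for \<omega>
  have "0 \<le> diameter X" using X(2) by (intro diameter_ge_0 compact_imp_bounded)
  then have "0 \<le> a" using \<open>0 < \<epsilon>\<close> by (simp add: a_def)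
  have "0 \<le> b" using \<open>0 < \<epsilon>\<close> \<open>0 < \<rho>\<close> by (simp add: b_def)
  have "0 \<le> c" by (simp add: c_def)
  have int: "integrable M (\<lambda>\<omega>. F x (\<xi> \<omega>))" if "x \<in> X" for x
    by (rule true_obj_integrable[where F = F and x = x, OF \<open>prob_space M\<close> \<xi> meas[OF that] bound[OF that]])
  have f_conv: "convex_on X f"
    unfolding f_def by (rule convex_on_true_obj[where F = F, OF \<open>prob_space M\<close> \<xi> X(3) int conv])
  have f_bdd: "bdd_below (f ` X)"
  proof (rule bdd_belowI2)
    fix x assume "x \<in> X"
    have "expectation (\<lambda>_. - B) \<le> f x"
      unfolding f_def true_obj_def using int[OF \<open>x \<in> X\<close>] bound[OF \<open>x \<in> X\<close>] measurable_space[OF \<xi>]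
      by (intro integral_mono) (auto simp: space_restrict_space abs_le_iff minus_le_iff)
    then show "- B \<le> f x" by (simp add: prob_space)
  qed
  have S_in: "S j \<omega> \<in> \<Xi>" if "j \<in> {1..m * n}" "\<omega> \<in> space M" for j \<omega>
  proof -
    have "S j \<in> M \<rightarrow>\<^sub>M restrict_space borel \<Xi>"
      using iid that(1) by (auto simp: iid_copies_def indep_vars_def)
    from measurable_space[OF this that(2)] show ?thesis by (simp add: space_restrict_space)
  qed
  \<comment> \<open>\<open>eps_selection\<close> constrains \<open>sel\<close> only on extensional
    functions; the restriction inside \<open>replication\<close> provides extensionality.\<close>
  have rep_in: "replication n (\<lambda>k. S k \<omega>) i \<in> {1..n} \<rightarrow>\<^sub>E \<Xi>" if "i \<in> {1..m}" "\<omega> \<in> space M" for i \<omega>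
  proof -
    have "(i - 1) * n + j \<in> {1..m * n}" if "j \<in> {1..n}" for j
    proof -
      have "(i - 1) * n + j \<le> (i - 1) * n + n" using that by simp
      also have "\<dots> = i * n" using \<open>i \<in> {1..m}\<close> by (cases i) auto
      also have "\<dots> \<le> m * n" using \<open>i \<in> {1..m}\<close> by simp
      finally show ?thesis using that by simp
    qed
    then show ?thesis using S_in that(2) by (auto simp: replication_def)
  qed
  have close_net: "\<bar>F x z - F v z\<bar> \<le> c"
    if "x \<in> X" "v \<in> V" "z \<in> \<Xi>" "norm (x - v) \<le> sqrt (real CARD('p)) * (D / (2 * real k))" for x v z
  proof -
    have "\<bar>F x z - F v z\<bar> \<le> L * norm (x - v) powr \<gamma>"
      using holder that V(3) by blast
    also have "\<dots> \<le> \<bar>L\<bar> * norm (x - v) powr \<gamma>"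
      by (intro mult_right_mono) auto
    also have "\<dots> \<le> c"
      unfolding c_def using that(4) \<open>0 < \<gamma>\<close> by (intro mult_left_mono powr_mono2) auto
    finally show ?thesis .
  qed
  \<comment> \<open>Moving from \<open>x\<close> to a net point costs \<open>c\<close> in the sample
    average and \<open>c\<close> in the true objective.\<close>
  have saa_close: "\<bar>saa_obj F n (replication n (\<lambda>k. S k \<omega>) i) x - f x\<bar> \<le> G i \<omega> + 2 * c"
    if "i \<in> {1..m}" "\<omega> \<in> space M" "x \<in> X" for i \<omega> x
  proof -
    define z where "z = replication n (\<lambda>k. S k \<omega>) i"
    have z: "z j \<in> \<Xi>" if "j \<in> {1..n}" for j
      using rep_in[OF \<open>i \<in> {1..m}\<close> \<open>\<omega> \<in> space M\<close>] that unfolding z_def by (rule PiE_mem)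
    obtain v where v: "v \<in> V" "norm (x - v) \<le> sqrt (real CARD('p)) * (D / (2 * real k))"
      using net[OF \<open>x \<in> X\<close>] by blast
    have "saa_obj F n z x - saa_obj F n z v = (1 / real n) * (\<Sum>j=1..n. F x (z j) - F v (z j))"
      unfolding saa_obj_def sum_subtractf by (simp add: right_diff_distrib)
    also have "\<bar>\<dots>\<bar> \<le> (1 / real n) * (\<Sum>j=1..n. \<bar>F x (z j) - F v (z j)\<bar>)"
      unfolding abs_mult by (intro mult_mono sum_abs) auto
    also have "\<dots> \<le> (1 / real n) * (\<Sum>j=1..n. c)"
      using close_net[OF \<open>x \<in> X\<close> v(1) _ v(2)] z by (intro mult_left_mono sum_mono) auto
    also have "\<dots> = c" using \<open>0 < n\<close> by simp
    finally have 1: "\<bar>saa_obj F n z x - saa_obj F n z v\<bar> \<le> c" .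
    have 2: "\<bar>f x - f v\<bar> \<le> c"
      unfolding f_def using v(1) V(3) \<open>x \<in> X\<close>
      by (intro true_obj_close[where F = F, OF \<open>prob_space M\<close> \<xi>] int close_net[OF _ v(1) _ v(2)]) auto
    have "\<bar>saa_obj F n z v - f v\<bar> \<le> G i \<omega>"
      unfolding G_def z_def using V(1) v(1) by (intro Max_ge) auto
    with 1 2 show ?thesis unfolding z_def[symmetric] by linarith
  qed
  have \<Delta>_range: "0 \<le> \<Delta> \<omega> \<and> \<Delta> \<omega> \<le> A \<omega>" if "\<omega> \<in> space M" for \<omega>
  proof -
    have y: "sel i (replication n (\<lambda>k. S k \<omega>) i)
        \<in> eps_solutions X (saa_obj F n (replication n (\<lambda>k. S k \<omega>) i)) \<epsilon>" if "i \<in> {1..m}" for i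
      using sel[OF that] rep_in[OF that \<open>\<omega> \<in> space M\<close>] by (simp add: eps_selection_def)
    have "a * (1 / real m * (\<Sum>i=1..m. G i \<omega> + 2 * c)) + b = A \<omega>"
      using \<open>0 < m\<close> by (simp add: A_def sum.distrib field_simps)
    with compromise_pess_dist[where g = "\<lambda>i. saa_obj F n (replication n (\<lambda>k. S k \<omega>) i)"
        and y = "\<lambda>i. sel i (replication n (\<lambda>k. S k \<omega>) i)" and d = "\<lambda>i. G i \<omega> + 2 * c",
        OF compact_imp_bounded[OF X(2)] f_conv f_bdd \<open>0 < \<epsilon>\<close> \<open>0 < \<rho>\<close> \<open>0 < m\<close> saa_close[OF _ that] y]
    show ?thesis
      by (simp only: \<Delta>_def compromise_dist_def compromise_obj_def[abs_def] f_def a_def b_def)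
  qed
  have V': "F v \<in> borel_measurable (restrict_space borel \<Xi>)" "\<And>z. z \<in> \<Xi> \<Longrightarrow> \<bar>F v z\<bar> \<le> B" if "v \<in> V" for v
    using meas bound V(3) that by auto
  note G_facts = saa_Max_deviation[where F = F and V = V, OF \<open>prob_space M\<close> \<xi> iid \<open>0 < n\<close> \<open>0 < B\<close> V(1,2) V']
  have G: "indep_vars (\<lambda>_. borel) G {1..m}"
    "\<And>i \<omega>. i \<in> {1..m} \<Longrightarrow> \<omega> \<in> space M \<Longrightarrow> 0 \<le> G i \<omega> \<and> G i \<omega> \<le> 2 * B"
    "\<And>i. i \<in> {1..m} \<Longrightarrow> expectation (G i) \<le> e"
    unfolding G_def[abs_def] f_def e_def using G_facts by blast+
  have "0 \<le> a * (2 * c) + b"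
    using \<open>0 \<le> a\<close> \<open>0 \<le> b\<close> \<open>0 \<le> c\<close> by simp
  note A_facts = second_moment_affine_average_le[where G = G, OF \<open>0 < m\<close> G \<open>0 \<le> a\<close> this]
  have A: "integrable M A" "integrable M (\<lambda>\<omega>. (A \<omega>)\<^sup>2)"
    "expectation A \<le> a * e + (a * (2 * c) + b)"
    "expectation (\<lambda>\<omega>. (A \<omega>)\<^sup>2) \<le> a\<^sup>2 * (2 * B) * e / real m + (a * e + (a * (2 * c) + b))\<^sup>2"
    unfolding A_def[abs_def] using A_facts by simp_all
  have \<Delta>_meas [measurable]: "random_variable borel \<Delta>"
    unfolding \<Delta>_def by (rule dist_meas)
  have int\<Delta>: "integrable M \<Delta>"
    using \<Delta>_range by (intro Bochner_Integration.integrable_bound[OF A(1)] AE_I2) force+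
  have int\<Delta>2: "integrable M (\<lambda>\<omega>. (\<Delta> \<omega>)\<^sup>2)"
  proof (rule Bochner_Integration.integrable_bound[OF A(2)], simp, rule AE_I2)
    show "norm ((\<Delta> \<omega>)\<^sup>2) \<le> norm ((A \<omega>)\<^sup>2)" if "\<omega> \<in> space M" for \<omega>
      using \<Delta>_range[OF that] by (simp add: power_mono)
  qed
  have E\<Delta>: "expectation \<Delta> \<le> a * e + (a * (2 * c) + b)"
    using integral_mono[OF int\<Delta> A(1)] \<Delta>_range A(3) by fastforce
  have "expectation (\<lambda>\<omega>. (\<Delta> \<omega>)\<^sup>2) \<le> expectation (\<lambda>\<omega>. (A \<omega>)\<^sup>2)"
    using \<Delta>_range by (intro integral_mono[OF int\<Delta>2 A(2)]) (simp add: power_mono)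
  with A(4) variance_eq[OF int\<Delta> int\<Delta>2]
  have V\<Delta>: "variance \<Delta> \<le> a\<^sup>2 * (2 * B) * e / real m + (a * e + (a * (2 * c) + b))\<^sup>2"
    using zero_le_power2[of "expectation \<Delta>"] by linarith
  text \<open>If \<open>X\<close> is a single point, then \<open>L\<close> may be negative, but \<open>a = 0\<close>.\<close>
  have err: "a * e \<le> a * (2 * N / real n powr l) \<and> a * (e + 2 * c) \<le> a * (2 * N / real n powr l)"
  proof (cases "a = 0")
    case False
    have "0 \<le> L"
    proof (rule ccontr)
      assume "\<not> 0 \<le> L"
      obtain \<omega> where "\<omega> \<in> space M" using not_empty by blast
      then have "\<xi> \<omega> \<in> \<Xi>" using measurable_space[OF \<xi>] by (simp add: space_restrict_space)
      have "x = y" if "x \<in> X" "y \<in> X" for x y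
      proof (rule ccontr)
        assume "x \<noteq> y"
        then have "L * norm (x - y) powr \<gamma> < 0"
          using \<open>\<not> 0 \<le> L\<close> by (intro mult_neg_pos) auto
        with holder[OF that \<open>\<xi> \<omega> \<in> \<Xi>\<close>] show False by linarith
      qed
      then obtain x where "X = {x}" using X(1) by blast
      then have "a = 0" by (simp add: a_def)
      with False show False by simp
    qed
    \<comment> \<open>\<open>N1\<close> pays for the discretization error \<open>c\<close> and
      \<open>N2\<close> for the maximal deviation \<open>e\<close>. Since \<open>c\<close> occurs
      twice, \<open>2 * N\<close> covers \<open>e + 2 * c\<close>.\<close>
    define N1 where "N1 = L * D powr \<gamma> * real CARD('p) powr (\<gamma> / 2)"
    define N2 where "N2 = B * sqrt (2 * ln 2) + B * sqrt (real CARD('p)) / sqrt (\<gamma> * (1 - 2 * l) * exp 1)"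
    have N: "N = N1 + N2" by (simp add: N_def N_F_def N1_def N2_def)
    have "c \<le> N1 / real n powr l"
      unfolding c_def N1_def k_def abs_of_nonneg[OF \<open>0 \<le> L\<close>]
      using \<open>0 < n\<close> \<open>0 < \<gamma>\<close> \<open>l < 1 / 2\<close> \<open>0 \<le> L\<close> \<open>0 \<le> D\<close> by (rule holder_grid_error)
    moreover have "e \<le> N2 / real n powr l"
      unfolding e_def N2_def using \<open>0 < B\<close> V
      by (intro massart_grid_error[OF \<open>0 < n\<close> \<open>0 < \<gamma>\<close> \<open>l < 1 / 2\<close>]) (auto simp: k_def card_gt_0_iff)
    moreover have "0 \<le> N1" "0 \<le> N2"
      using \<open>0 \<le> L\<close> \<open>0 < B\<close> \<open>0 < \<gamma>\<close> \<open>l < 1 / 2\<close> by (auto simp: N1_def N2_def intro!: add_nonneg_nonneg)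
    then have "0 \<le> N1 / real n powr l" "0 \<le> N2 / real n powr l" by auto
    ultimately have "e \<le> 2 * N / real n powr l" "e + 2 * c \<le> 2 * N / real n powr l"
      unfolding N add_divide_distrib distrib_left by linarith+
    then show ?thesis using \<open>0 \<le> a\<close> by (intro conjI mult_left_mono)
  qed simp
  have aN: "a * (2 * N / real n powr l) = 8 * diameter X * N / (\<epsilon> * real n powr l)"
    by (simp add: a_def)
  have mean_le: "a * e + (a * (2 * c) + b) \<le> 8 * diameter X * N / (\<epsilon> * real n powr l) + 2 * sqrt (\<epsilon> / \<rho>)"
    using err unfolding aN b_def distrib_left by linarith
  have "0 \<le> expectation \<Delta>"
    using \<Delta>_range by (intro integral_nonneg_AE AE_I2) auto
  then show "expectation \<Delta> \<in> {0..8 * diameter X * N / (\<epsilon> * real n powr l) + 2 * sqrt (\<epsilon> / \<rho>)}"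
    using E\<Delta> mean_le by simp
  \<comment> \<open>\<open>err\<close> controls \<open>a * e\<close> rather than \<open>e\<close>,
    so one factor \<open>a\<close> is split off. The constant is then 64 = 4 * 2 * 8.\<close>
  have "a\<^sup>2 * (2 * B) * e / real m = a * (2 * B) / real m * (a * e)"
    by (simp add: power2_eq_square)
  also have "\<dots> \<le> a * (2 * B) / real m * (8 * diameter X * N / (\<epsilon> * real n powr l))"
    using err \<open>0 \<le> a\<close> \<open>0 < B\<close> unfolding aN by (intro mult_left_mono) auto
  also have "\<dots> = 64 * (diameter X)\<^sup>2 * B * N / (real m * \<epsilon>\<^sup>2 * real n powr l)"
    by (simp add: a_def power2_eq_square mult_ac)
  finally have var1: "a\<^sup>2 * (2 * B) * e / real m \<le> 64 * (diameter X)\<^sup>2 * B * N / (real m * \<epsilon>\<^sup>2 * real n powr l)" .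
  have "0 \<le> a * e + (a * (2 * c) + b)"
    using \<open>0 \<le> expectation \<Delta>\<close> E\<Delta> by linarith
  with mean_le have "(a * e + (a * (2 * c) + b))\<^sup>2
      \<le> (8 * diameter X * N / (\<epsilon> * real n powr l) + 2 * sqrt (\<epsilon> / \<rho>))\<^sup>2"
    by (rule power_mono)
  with V\<Delta> var1 show "variance \<Delta>
      \<le> 64 * (diameter X)\<^sup>2 * B * N / (real m * \<epsilon>\<^sup>2 * real n powr l)
        + (8 * diameter X * N / (\<epsilon> * real n powr l) + 2 * sqrt (\<epsilon> / \<rho>))\<^sup>2"
    by linarith
qed

text \<open>Quantifying \<open>C\<^sub>E\<close> and \<open>C\<^sub>V\<close> before
  \<open>m\<close>, \<open>n\<close>, \<open>\<rho>\<close>, the sample and the selections expresses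
  the uniformity of the implied constants; the rates hold for all positive \<open>m\<close> and
  \<open>n\<close>, not just eventually.\<close>

theorem theorem3p7:
  fixes M :: "'w measure"
    and X :: "(real ^ 'p) set"
    and \<Xi> :: "(real ^ 'd) set"
    and \<xi> :: "'w \<Rightarrow> real ^ 'd"
    and F :: "real ^ 'p \<Rightarrow> real ^ 'd \<Rightarrow> real"
    and D L\<^sub>F M\<^sub>F \<gamma> l \<epsilon> :: real
  assumes "prob_space M"
    and "\<xi> \<in> M \<rightarrow>\<^sub>M restrict_space borel \<Xi>"
    and "X \<noteq> {}" "compact X" "convex X"
    and "contained_in_cube X D"
    and "caratheodory X \<Xi> F"
    and "0 < \<gamma>" "\<gamma> \<le> 1"
    and "\<And>x y z. x \<in> X \<Longrightarrow> y \<in> X \<Longrightarrow> z \<in> \<Xi> \<Longrightarrow> \<bar>F x z - F y z\<bar> \<le> L\<^sub>F * norm (x - y) powr \<gamma>"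
    and "0 < M\<^sub>F"
    and "bdd_above ((\<lambda>(x, z). \<bar>F x z\<bar>) ` (X \<times> \<Xi>))"
    and "(SUP (x, z)\<in>X \<times> \<Xi>. \<bar>F x z\<bar>) < M\<^sub>F"
    and "\<And>z. z \<in> \<Xi> \<Longrightarrow> convex_on X (\<lambda>x. F x z)"
    and "0 < l" "l < 1 / 2"
    and "0 < \<epsilon>"
  shows
    "(\<forall>m n \<rho> S sel. 0 < m \<longrightarrow> 0 < n \<longrightarrow> 0 < \<rho> \<longrightarrow>
        iid_copies M \<Xi> \<xi> (m * n) S \<longrightarrow>
        (\<forall>i\<in>{1..m}. eps_selection X \<Xi> F n \<epsilon> (sel i)) \<longrightarrow>
        compromise_dist M X \<xi> F m n \<rho> \<epsilon> sel S \<in> borel_measurable M \<longrightarrow>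
        prob_space.variance M (compromise_dist M X \<xi> F m n \<rho> \<epsilon> sel S)
          \<le> 64 * (diameter X)\<^sup>2 * M\<^sub>F * N_F L\<^sub>F \<gamma> D CARD('p) M\<^sub>F l
              / (real m * \<epsilon>\<^sup>2 * real n powr l)
            + (8 * diameter X * N_F L\<^sub>F \<gamma> D CARD('p) M\<^sub>F l / (\<epsilon> * real n powr l)
               + 2 * sqrt (\<epsilon> / \<rho>))\<^sup>2) \<and>
     (\<forall>K>0. \<exists>C\<^sub>E C\<^sub>V. \<forall>m n \<rho> S sel. 0 < m \<longrightarrow> 0 < n \<longrightarrow> 0 < \<rho> \<longrightarrow> K * real n \<le> \<rho> \<longrightarrow>
        iid_copies M \<Xi> \<xi> (m * n) S \<longrightarrow>
        (\<forall>i\<in>{1..m}. eps_selection X \<Xi> F n \<epsilon> (sel i)) \<longrightarrow>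
        compromise_dist M X \<xi> F m n \<rho> \<epsilon> sel S \<in> borel_measurable M \<longrightarrow>
        \<bar>prob_space.expectation M (compromise_dist M X \<xi> F m n \<rho> \<epsilon> sel S)\<bar>
          \<le> C\<^sub>E * (1 / real n powr l) \<and>
        \<bar>prob_space.variance M (compromise_dist M X \<xi> F m n \<rho> \<epsilon> sel S)\<bar>
          \<le> C\<^sub>V * (1 / (real m * real n powr l) + 1 / real n powr (2 * l)))"
proof -
  define N where "N = N_F L\<^sub>F \<gamma> D CARD('p) M\<^sub>F l"
  define P where "P m n \<rho> S sel \<longleftrightarrow> 0 < m \<and> 0 < n \<and> 0 < \<rho> \<and> iid_copies M \<Xi> \<xi> (m * n) S \<and>
      (\<forall>i\<in>{1..m}. eps_selection X \<Xi> F n \<epsilon> (sel i)) \<and>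
      compromise_dist M X \<xi> F m n \<rho> \<epsilon> sel S \<in> borel_measurable M" for m n \<rho> S sel
  have meas: "F x \<in> borel_measurable (restrict_space borel \<Xi>)" if "x \<in> X" for x
    using assms(7) that by (simp add: caratheodory_def)
  have bound: "\<bar>F x z\<bar> \<le> M\<^sub>F" if "x \<in> X" "z \<in> \<Xi>" for x z
    using cSUP_upper[OF _ assms(12), of "(x, z)"] assms(13) that by simp
  have mean: "prob_space.expectation M (compromise_dist M X \<xi> F m n \<rho> \<epsilon> sel S)
      \<in> {0..8 * diameter X * N / (\<epsilon> * real n powr l) + 2 * sqrt (\<epsilon> / \<rho>)}"
    and var: "prob_space.variance M (compromise_dist M X \<xi> F m n \<rho> \<epsilon> sel S)
      \<le> 64 * (diameter X)\<^sup>2 * M\<^sub>F * N / (real m * \<epsilon>\<^sup>2 * real n powr l)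
        + (8 * diameter X * N / (\<epsilon> * real n powr l) + 2 * sqrt (\<epsilon> / \<rho>))\<^sup>2"
    if "P m n \<rho> S sel" for m n \<rho> S sel
  proof -
    have "0 < m" "0 < n" "0 < \<rho>" "iid_copies M \<Xi> \<xi> (m * n) S"
      "\<And>i. i \<in> {1..m} \<Longrightarrow> eps_selection X \<Xi> F n \<epsilon> (sel i)"
      "compromise_dist M X \<xi> F m n \<rho> \<epsilon> sel S \<in> borel_measurable M"
      using that by (simp_all only: P_def)
    note moments = compromise_dist_moments[where F = F and \<gamma> = \<gamma> and L = L\<^sub>F,
        OF assms(1-6) meas assms(8,10,11) bound assms(14,16,17) this, folded N_def]
    show "prob_space.expectation M (compromise_dist M X \<xi> F m n \<rho> \<epsilon> sel S)
        \<in> {0..8 * diameter X * N / (\<epsilon> * real n powr l) + 2 * sqrt (\<epsilon> / \<rho>)}"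
      by (rule moments(1))
    show "prob_space.variance M (compromise_dist M X \<xi> F m n \<rho> \<epsilon> sel S)
        \<le> 64 * (diameter X)\<^sup>2 * M\<^sub>F * N / (real m * \<epsilon>\<^sup>2 * real n powr l)
          + (8 * diameter X * N / (\<epsilon> * real n powr l) + 2 * sqrt (\<epsilon> / \<rho>))\<^sup>2"
      by (rule moments(2))
  qed
  have rates: "\<exists>C\<^sub>E C\<^sub>V. \<forall>m n \<rho> S sel. P m n \<rho> S sel \<longrightarrow> K * real n \<le> \<rho> \<longrightarrow>
        \<bar>prob_space.expectation M (compromise_dist M X \<xi> F m n \<rho> \<epsilon> sel S)\<bar>
          \<le> C\<^sub>E * (1 / real n powr l) \<and>
        \<bar>prob_space.variance M (compromise_dist M X \<xi> F m n \<rho> \<epsilon> sel S)\<bar>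
          \<le> C\<^sub>V * (1 / (real m * real n powr l) + 1 / real n powr (2 * l))" if "0 < K" for K
  proof -
    \<comment> \<open>From \<open>K * real n \<le> \<rho>\<close> the proximal term is at most
      \<open>2 * sqrt (\<epsilon> / K) / sqrt n\<close>, and \<open>l < 1 / 2\<close> lets
      \<open>n powr l\<close> replace \<open>sqrt n\<close>.\<close>
    define C where "C = 8 * diameter X * N / \<epsilon> + 2 * sqrt (\<epsilon> / K)"
    \<comment> \<open>\<open>N\<close> has no known sign here, as \<open>L\<^sub>F\<close> may be
      negative when \<open>X\<close> is a single point.\<close>
    define C' where "C' = \<bar>64 * (diameter X)\<^sup>2 * M\<^sub>F * N / \<epsilon>\<^sup>2\<bar>"
    show ?thesis
    proof (rule exI[of _ C], rule exI[of _ "C' + C\<^sup>2"], intro allI impI)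
      fix m n \<rho> S sel assume P: "P m n \<rho> S sel" and \<rho>: "K * real n \<le> \<rho>"
      let ?\<Delta> = "compromise_dist M X \<xi> F m n \<rho> \<epsilon> sel S"
      let ?u = "1 / (real m * real n powr l)"
      have n: "0 < n" "0 < m" and "0 < \<rho>" using P by (simp_all add: P_def)
      have "\<epsilon> / \<rho> \<le> \<epsilon> / (K * real n)"
        using \<rho> n \<open>0 < K\<close> \<open>0 < \<rho>\<close> \<open>0 < \<epsilon>\<close> by (intro divide_left_mono mult_pos_pos) auto
      then have "sqrt (\<epsilon> / \<rho>) \<le> sqrt (\<epsilon> / (K * real n))"
        by (rule real_sqrt_le_mono)
      also have "\<dots> = sqrt (\<epsilon> / K) / real n powr (1 / 2)"
        by (simp add: powr_half_sqrt real_sqrt_divide real_sqrt_mult)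
      also have "\<dots> \<le> sqrt (\<epsilon> / K) / real n powr l"
        using n \<open>0 < \<epsilon>\<close> \<open>0 < K\<close> assms(16) by (intro divide_left_mono powr_mono mult_pos_pos) auto
      finally have rate: "8 * diameter X * N / (\<epsilon> * real n powr l) + 2 * sqrt (\<epsilon> / \<rho>) \<le> C / real n powr l"
        by (simp add: C_def add_divide_distrib)
      \<comment> \<open>The interval in \<open>mean\<close> is inhabited, so its right end is
        nonnegative and may be squared.\<close>
      have "0 \<le> 8 * diameter X * N / (\<epsilon> * real n powr l) + 2 * sqrt (\<epsilon> / \<rho>)"
        using mean[OF P] by simp
      then have "(8 * diameter X * N / (\<epsilon> * real n powr l) + 2 * sqrt (\<epsilon> / \<rho>))\<^sup>2 \<le> (C / real n powr l)\<^sup>2"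
        using rate by (intro power_mono)
      also have "\<dots> = C\<^sup>2 * (1 / real n powr (2 * l))"
        using n by (simp add: power_divide powr_power mult.commute)
      finally have 1: "(8 * diameter X * N / (\<epsilon> * real n powr l) + 2 * sqrt (\<epsilon> / \<rho>))\<^sup>2
        \<le> C\<^sup>2 * (1 / real n powr (2 * l))" .
      have "64 * (diameter X)\<^sup>2 * M\<^sub>F * N / (real m * \<epsilon>\<^sup>2 * real n powr l)
          = 64 * (diameter X)\<^sup>2 * M\<^sub>F * N / \<epsilon>\<^sup>2 * ?u"
        by simp
      also have "\<dots> \<le> C' * ?u"
        unfolding C'_def by (rule mult_right_mono[OF abs_ge_self]) simp
      finally have "prob_space.variance M ?\<Delta> \<le> C' * ?u + C\<^sup>2 * (1 / real n powr (2 * l))"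
        using var[OF P] 1 by linarith
      also have "\<dots> \<le> (C' + C\<^sup>2) * ?u + (C' + C\<^sup>2) * (1 / real n powr (2 * l))"
        by (intro add_mono mult_right_mono) (auto simp: C'_def)
      finally have "prob_space.variance M ?\<Delta> \<le> (C' + C\<^sup>2) * (?u + 1 / real n powr (2 * l))"
        by (simp add: distrib_left)
      moreover have "0 \<le> prob_space.variance M ?\<Delta>"
        by (rule prob_space.variance_positive[OF assms(1)])
      ultimately show "\<bar>prob_space.expectation M ?\<Delta>\<bar> \<le> C * (1 / real n powr l) \<and>
          \<bar>prob_space.variance M ?\<Delta>\<bar> \<le> (C' + C\<^sup>2) * (?u + 1 / real n powr (2 * l))"
        using mean[OF P] rate by simp
    qed
  qed
  show ?thesis
  proof (rule conjI; intro allI impI)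
    show "prob_space.variance M (compromise_dist M X \<xi> F m n \<rho> \<epsilon> sel S)
        \<le> 64 * (diameter X)\<^sup>2 * M\<^sub>F * N_F L\<^sub>F \<gamma> D CARD('p) M\<^sub>F l / (real m * \<epsilon>\<^sup>2 * real n powr l)
          + (8 * diameter X * N_F L\<^sub>F \<gamma> D CARD('p) M\<^sub>F l / (\<epsilon> * real n powr l) + 2 * sqrt (\<epsilon> / \<rho>))\<^sup>2"
      if "0 < m" "0 < n" "0 < \<rho>" "iid_copies M \<Xi> \<xi> (m * n) S"
        "\<forall>i\<in>{1..m}. eps_selection X \<Xi> F n \<epsilon> (sel i)"
        "compromise_dist M X \<xi> F m n \<rho> \<epsilon> sel S \<in> borel_measurable M" for m n \<rho> S sel
      unfolding N_def[symmetric] using that by (intro var) (simp only: P_def simp_thms)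
  next
    fix K :: real assume "0 < K"
    from rates[OF this] obtain C\<^sub>E C\<^sub>V where C: "\<And>m n \<rho> S sel. P m n \<rho> S sel \<Longrightarrow> K * real n \<le> \<rho> \<Longrightarrow>
        \<bar>prob_space.expectation M (compromise_dist M X \<xi> F m n \<rho> \<epsilon> sel S)\<bar>
          \<le> C\<^sub>E * (1 / real n powr l) \<and>
        \<bar>prob_space.variance M (compromise_dist M X \<xi> F m n \<rho> \<epsilon> sel S)\<bar>
          \<le> C\<^sub>V * (1 / (real m * real n powr l) + 1 / real n powr (2 * l))"
      by (elim exE) metis
    show "\<exists>C\<^sub>E C\<^sub>V. \<forall>m n \<rho> S sel. 0 < m \<longrightarrow> 0 < n \<longrightarrow> 0 < \<rho> \<longrightarrow> K * real n \<le> \<rho> \<longrightarrow>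
        iid_copies M \<Xi> \<xi> (m * n) S \<longrightarrow>
        (\<forall>i\<in>{1..m}. eps_selection X \<Xi> F n \<epsilon> (sel i)) \<longrightarrow>
        compromise_dist M X \<xi> F m n \<rho> \<epsilon> sel S \<in> borel_measurable M \<longrightarrow>
        \<bar>prob_space.expectation M (compromise_dist M X \<xi> F m n \<rho> \<epsilon> sel S)\<bar>
          \<le> C\<^sub>E * (1 / real n powr l) \<and>
        \<bar>prob_space.variance M (compromise_dist M X \<xi> F m n \<rho> \<epsilon> sel S)\<bar>
          \<le> C\<^sub>V * (1 / (real m * real n powr l) + 1 / real n powr (2 * l))"
      by (rule exI[of _ C\<^sub>E], rule exI[of _ C\<^sub>V], intro allI impI, rule C)
        (simp_all only: P_def simp_thms)
  qed
qed

end
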